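(* Let $k\ge1$ and let $K\subset\mathbb{R}^3$ be a (nondegenerate) tetrahedron. Then the following conditions form unisolvent degrees of freedom for $\Sigma^{\rm nc}_k(K)$: (1) $\displaystyle\int_F\tau\nu\cdot v\,ds$ for any $v\in P_k(F;\mathbb{R}^3)$ and any face $F\subset\partial K$; (2) $\displaystyle\int_K\tau:p\,dx$ for any $p\in H_{K,k+1,b}$.
   Context: Let $\boldsymbol{x}_1,\dots,\boldsymbol{x}_4$ be the vertices of $K$, $\lambda_1,\dots,\lambda_4$ the corresponding barycentric coordinates, and $\boldsymbol{t}_{i,j}=\boldsymbol{x}_j-\boldsymbol{x}_i$ for $i\ne j$. $\nu$ is the normal vector of $\partial K$. $P_m(\omega;X)$ is the space of polynomials of total degree at most $m$ on $\omega$ with values in $X$. For matrices, $a:b$ is the Frobenius inner product. Define $\widetilde P_k(\lambda_\ell,\lambda_m)=\operatorname{span}\{\lambda_\ell^{m_1}\lambda_m^{m_2}: m_1,m_2\ge 0,\ m_1+m_2=k\}$. The shape function space is $$\Sigma^{\rm nc}_k(K)=\Big\{\tau=\sum_{1\le i<j\le4}p_{ij}\,\boldsymbol{t}_{i,j}\boldsymbol{t}_{i,j}^T\ :\ p_{ij}\in P_{ij}\Big\},$$ $$P_{ij}=P_k(K;\mathbb{R})+(\lambda_i-\lambda_j)\widetilde P_k(\lambda_\ell,\lambda_m)+\lambda_i\lambda_jP_{k-1}(K;\mathbb{R}),\qquad \{\ell,m\}=\{1,2,3,4\}\setminus\{i,j\},$$ and $$H_{K,k+1,b}=\sum_{1\le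 i<j\le4}\lambda_i\lambda_jP_{k-1}(K;\mathbb{R})\,\boldsymbol{t}_{i,j}\boldsymbol{t}_{i,j}^T .$$ "Unisolvent degrees of freedom" means: the number of conditions (with $v$ and $p$ running over bases of the respective test spaces, and $F$ over the four faces) equals $\dim\Sigma^{\rm nc}_k(K)$, and if all of them vanish for some $\tau\in\Sigma^{\rm nc}_k(K)$ then $\tau=0$. *)

theory Defs
  imports "HOL-Analysis.Analysis" "HOL-Library.Function_Algebras"
begin

section \<open>Function spaces\<close>

text \<open>
  Functions into a real vector space form a real vector space under the pointwise operations, so
  that \<open>span\<close>, \<open>independent\<close> and \<open>dim\<close> apply to spaces of functions.
\<close>

instantiation "fun" :: (type, real_vector) real_vector
begin

definition scaleR_fun :: "real \<Rightarrow> ('a \<Rightarrow> 'b) \<Rightarrow> 'a \<Rightarrow> 'b"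
  where "scaleR_fun c f = (\<lambda>y. c *\<^sub>R f y)"

instance
  by standard (auto simp: scaleR_fun_def plus_fun_def fun_eq_iff algebra_simps)

end

text \<open>
  A function on \<open>\<omega>\<close> is encoded as a function on the whole space that vanishes outside \<open>\<omega>\<close>.
  Equality of two encodings is thus equality on \<open>\<omega>\<close>; in particular the dimension of
  a space of polynomials on a face (contained in a plane) is the dimension of the restrictions.
\<close>

definition restr :: "'a set \<Rightarrow> ('a \<Rightarrow> 'b::zero) \<Rightarrow> 'a \<Rightarrow> 'b"
  where "restr \<omega> f = (\<lambda>y. if y \<in> \<omega> then f y else 0)"

definition poly_space :: "nat \<Rightarrow> (real^3) set \<Rightarrow> (real^3 \<Rightarrow> 'b::real_vector) set"
  where "poly_space m \<omega> =
    span {restr \<omega> (\<lambda>y. (\<Prod>d\<in>UNIV. y $ d ^ a d) *\<^sub>R c) | (a :: 3 \<Rightarrow> nat) c. (\<Sum>d\<in>UNIV. a d) \<le> m}"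

definition is_basis :: "'v::real_vector set \<Rightarrow> 'v set \<Rightarrow> bool"
  where "is_basis B V \<longleftrightarrow> independent B \<and> span B = V"

text \<open>
  Finiteness of the index set is required explicitly because \<open>card\<close> is \<open>0\<close> on infinite sets.
\<close>

definition unisolvent :: "'i set \<Rightarrow> ('i \<Rightarrow> 'v::real_vector \<Rightarrow> real) \<Rightarrow> 'v set \<Rightarrow> bool"
  where "unisolvent I L V \<longleftrightarrow>
    finite I \<and> card I = dim V \<and> (\<forall>\<tau>\<in>V. (\<forall>i\<in>I. L i \<tau> = 0) \<longrightarrow> \<tau> = 0)"


section \<open>The tetrahedron\<close>

text \<open>The vertices are \<open>x 1, \<dots>, x 4\<close>; the values of \<open>x\<close> at other indices are irrelevant.\<close>

definition nondegenerate :: "(nat \<Rightarrow> real^3) \<Rightarrow> bool"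
  where "nondegenerate x \<longleftrightarrow> inj_on x {1..4} \<and> \<not> affine_dependent (x ` {1..4})"

definition tetra :: "(nat \<Rightarrow> real^3) \<Rightarrow> (real^3) set"
  where "tetra x = convex hull (x ` {1..4})"

text \<open>The face opposite to the vertex \<open>x i\<close>.\<close>

definition face :: "(nat \<Rightarrow> real^3) \<Rightarrow> nat \<Rightarrow> (real^3) set"
  where "face x i = convex hull (x ` ({1..4} - {i}))"

definition bary :: "(nat \<Rightarrow> real^3) \<Rightarrow> nat \<Rightarrow> real^3 \<Rightarrow> real"
  where "bary x i y =
    (THE l. (\<forall>j. j \<notin> {1..4} \<longrightarrow> l j = 0) \<and> (\<Sum>j=1..4. l j) = 1 \<and> (\<Sum>j=1..4. l j *\<^sub>R x j) = y) i"

definition tangent :: "(nat \<Rightarrow> real^3) \<Rightarrow> nat \<Rightarrow> nat \<Rightarrow> real^3"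
  where "tangent x i j = x j - x i"

definition self_outer :: "real^3 \<Rightarrow> real^3^3"
  where "self_outer t = (\<chi> a b. t $ a * t $ b)"

text \<open>
  The outward unit normal on the face opposite to \<open>x i\<close>: the inequality says that the tetrahedron
  lies on the inner side of the face, and, as both \<open>y\<close> and \<open>z\<close> may range over the
  face, that the vector is orthogonal to the face.
\<close>

definition normal :: "(nat \<Rightarrow> real^3) \<Rightarrow> nat \<Rightarrow> real^3"
  where "normal x i =
    (THE n. norm n = 1 \<and> (\<forall>y\<in>face x i. \<forall>z\<in>tetra x. n \<bullet> (z - y) \<le> 0))"

text \<open>
  Surface integral over the triangle with vertices \<open>a\<close>, \<open>b\<close>, \<open>c\<close>, through its affine
  parametrization over the reference triangle; the norm of the cross product is the (constant)
  area element. The value does not depend on the order of the vertices.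
\<close>

definition triangle_integral ::
    "real^3 \<Rightarrow> real^3 \<Rightarrow> real^3 \<Rightarrow> (real^3 \<Rightarrow> real) \<Rightarrow> real"
  where "triangle_integral a b c f =
    (LINT (s, t) : {(s, t). 0 \<le> s \<and> 0 \<le> t \<and> s + t \<le> 1} | lborel.
       f (a + s *\<^sub>R (b - a) + t *\<^sub>R (c - a)) * norm (cross3 (b - a) (c - a)))"

definition face_integral :: "(nat \<Rightarrow> real^3) \<Rightarrow> nat \<Rightarrow> (real^3 \<Rightarrow> real) \<Rightarrow> real"
  where "face_integral x i f =
    (let js = sorted_list_of_set ({1..4} - {i})
     in triangle_integral (x (js ! 0)) (x (js ! 1)) (x (js ! 2)) f)"


section \<open>The finite element\<close>

definition hom_poly_space ::
    "(nat \<Rightarrow> real^3) \<Rightarrow> nat \<Rightarrow> nat \<Rightarrow> nat \<Rightarrow> (real^3 \<Rightarrow> real) set"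
  where "hom_poly_space x k l m =
    span {restr (tetra x) (\<lambda>y. bary x l y ^ m1 * bary x m y ^ m2) | m1 m2. m1 + m2 = k}"

text \<open>
  The pair \<open>l\<close>, \<open>m\<close> below is determined up to order, and \<open>hom_poly_space\<close> is symmetric in it.
\<close>

definition coeff_space :: "(nat \<Rightarrow> real^3) \<Rightarrow> nat \<Rightarrow> nat \<Rightarrow> nat \<Rightarrow> (real^3 \<Rightarrow> real) set"
  where "coeff_space x k i j =
    {\<lambda>y. p y + (bary x i y - bary x j y) * q y + bary x i y * bary x j y * r y | p q r l m.
       {l, m} = {1..4} - {i, j} \<and> p \<in> poly_space k (tetra x) \<and>
       q \<in> hom_poly_space x k l m \<and> r \<in> poly_space (k - 1) (tetra x)}"

definition Sigma_nc :: "(nat \<Rightarrow> real^3) \<Rightarrow> nat \<Rightarrow> (real^3 \<Rightarrow> real^3^3) set"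
  where "Sigma_nc x k =
    {\<lambda>y. \<Sum>(i, j) | 1 \<le> i \<and> i < j \<and> j \<le> 4. p i j y *\<^sub>R self_outer (tangent x i j) | p.
       \<forall>i j. 1 \<le> i \<and> i < j \<and> j \<le> 4 \<longrightarrow> p i j \<in> coeff_space x k i j}"

text \<open>The space \<open>H\<^bsub>K,k+1,b\<^esub>\<close>, indexed by \<open>k\<close>.\<close>

definition H_bubble :: "(nat \<Rightarrow> real^3) \<Rightarrow> nat \<Rightarrow> (real^3 \<Rightarrow> real^3^3) set"
  where "H_bubble x k =
    {\<lambda>y. \<Sum>(i, j) | 1 \<le> i \<and> i < j \<and> j \<le> 4.
           (bary x i y * bary x j y * r i j y) *\<^sub>R self_outer (tangent x i j) | r.
       \<forall>i j. 1 \<le> i \<and> i < j \<and> j \<le> 4 \<longrightarrow> r i j \<in> poly_space (k - 1) (tetra x)}"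

definition face_dof ::
    "(nat \<Rightarrow> real^3) \<Rightarrow> nat \<Rightarrow> (real^3 \<Rightarrow> real^3) \<Rightarrow> (real^3 \<Rightarrow> real^3^3) \<Rightarrow> real"
  where "face_dof x i v \<tau> = face_integral x i (\<lambda>y. (\<tau> y *v normal x i) \<bullet> v y)"

text \<open>On matrices, the library's inner product \<open>\<bullet>\<close> is the Frobenius inner product.\<close>

definition interior_dof ::
    "(nat \<Rightarrow> real^3) \<Rightarrow> (real^3 \<Rightarrow> real^3^3) \<Rightarrow> (real^3 \<Rightarrow> real^3^3) \<Rightarrow> real"
  where "interior_dof x p \<tau> = (LINT y : tetra x | lborel. \<tau> y \<bullet> p y)"

end

theory Submission
  imports Defs
begin

text \<open>
  The six matrices \<open>t\<^sub>i\<^sub>j t\<^sub>i\<^sub>j\<^sup>T\<close> are dual to the pairs of barycentric gradients: with \<open>g\<^sub>i\<close> the gradient of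
  \<open>\<lambda>\<^sub>i\<close>, the number \<open>(t\<^sub>a\<^sub>b \<bullet> g\<^sub>i) (t\<^sub>a\<^sub>b \<bullet> g\<^sub>j)\<close> is \<open>- 1\<close> if \<open>{a, b} = {i, j}\<close> and \<open>0\<close> for every other pair. As the
  normal of the face \<open>F\<^sub>i\<close> is a multiple of \<open>g\<^sub>i\<close>, testing \<open>\<tau> \<nu>\<close> on \<open>F\<^sub>i\<close> with \<open>\<phi> g\<^sub>j\<close> isolates the single
  coefficient \<open>p\<^sub>i\<^sub>j\<close>. The face conditions thus decouple: they are the moments of degree at most \<open>k\<close> of each
  \<open>p\<^sub>i\<^sub>j\<close> on the two faces \<open>F\<^sub>i\<close> and \<open>F\<^sub>j\<close> (\<open>coefficient_moment_zero\<close>).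

  Let \<open>\<pi>\<^sub>i\<^sub>j\<close> be the projection onto the plane of \<open>F\<^sub>i\<close> along the edge \<open>t\<^sub>i\<^sub>j\<close>. The key to the coefficient
  space is the normal form
  \<open>P\<^sub>i\<^sub>j = {u \<circ> \<pi>\<^sub>i\<^sub>j + (\<lambda>\<^sub>j - \<lambda>\<^sub>i) (h \<circ> \<pi>\<^sub>j\<^sub>i) + \<lambda>\<^sub>i \<lambda>\<^sub>j r}\<close> with \<open>u\<close>, \<open>h\<close> of degree at most \<open>k\<close>
  and \<open>r\<close> of degree at most \<open>k - 1\<close> (\<open>coeff_space_eq\<close>); \<open>u\<close> and \<open>h\<close> matter only through their values on \<open>F\<^sub>i\<close>
  and \<open>F\<^sub>j\<close>. Identify the two faces by the affine map that exchanges the vertices \<open>i\<close> and \<open>j\<close>, and let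
  \<open>s\<close> be the barycentric coordinate of the exchanged vertex, which vanishes on the common edge. Then the traces are
  \<open>u + s h\<close> on \<open>F\<^sub>i\<close> and \<open>u - s h\<close> on \<open>F\<^sub>j\<close>. If both are orthogonal to the polynomials of degree at
  most \<open>k\<close>, then so are \<open>u\<close> and \<open>s h\<close>; hence \<open>\<integral> u\<^sup>2 = 0\<close> and \<open>\<integral> s h\<^sup>2 = 0\<close>, and \<open>u = h = 0\<close>
  (\<open>traces_zero\<close>). What remains of \<open>\<tau>\<close> lies in the bubble space and is orthogonal to it, so it is \<open>0\<close>.

  The same normal form gives the dimension. Collecting the functions \<open>u\<close> and \<open>h\<close> that live on one face
  \<open>F\<^sub>i\<close> as the components of one vector field \<open>v\<^sub>i\<close>, every \<open>\<tau>\<close> is \<open>assemble v + c\<close> with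
  \<open>v\<^sub>i\<close> in \<open>P\<^sub>k(F\<^sub>i; \<real>\<^sup>3)\<close> and \<open>c\<close> in the bubble space, and every such sum is a shape function
  (\<open>Sigma_nc_decompose\<close>, \<open>assemble_in_Sigma_nc\<close>). Since vanishing degrees of freedom force \<open>v = 0\<close> and \<open>c = 0\<close>
  (\<open>decomposition_unisolvent\<close>), this correspondence is a linear bijection: bases of the test spaces are
  mapped to a basis of the shape function space, and no dimension has to be computed.
\<close>

section \<open>Linear algebra\<close>

lemma self_outer_mult_inner: "(self_outer t *v n) \<bullet> g = (t \<bullet> n) * (t \<bullet> g)"
proof -
  have "self_outer t *v n = (t \<bullet> n) *\<^sub>R t"
    by (simp add: vec_eq_iff self_outer_def matrix_vector_mult_def inner_vec_def sum_distrib_left mult_ac)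
  then show ?thesis by simp
qed

lemma linear_matrix_vector_mult_left: "linear (\<lambda>A :: real^'n^'m. A *v n)"
  by (rule linearI) (simp_all add: matrix_vector_mult_add_rdistrib scaleR_matrix_vector_assoc)

text \<open>
  The index matters: a family that takes a value twice could have an independent image, but it has
  a nontrivial linear relation.
\<close>

lemma independent_family:
  fixes e :: "'i \<Rightarrow> 'v::real_vector"
  assumes fin: "finite I" and zero: "\<And>a z. (\<Sum>z\<in>I. a z *\<^sub>R e z) = 0 \<Longrightarrow> z \<in> I \<Longrightarrow> a z = 0"
  shows "inj_on e I" "independent (e ` I)"
proof -
  show inj: "inj_on e I"
  proof (rule inj_onI, rule ccontr)
    fix z w assume zw: "z \<in> I" "w \<in> I" "e z = e w" "z \<noteq> w"
    let ?a = "\<lambda>y. (if y = z then 1 else 0) - (if y = w then 1 else (0::real))"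
    have "(\<Sum>y\<in>I. ?a y *\<^sub>R e y) = (\<Sum>y\<in>I. if y = z then e z else 0) - (\<Sum>y\<in>I. if y = w then e w else 0)"
      unfolding sum_subtractf[symmetric] by (rule sum.cong) auto
    also have "\<dots> = 0"
      using fin zw by simp
    finally have "?a z = 0"
      using zw(1) by (rule zero)
    then show False
      using zw by simp
  qed
  show "independent (e ` I)"
    unfolding dependent_finite[OF finite_imageI[OF fin]]
  proof safe
    fix u z assume "(\<Sum>v\<in>e ` I. u v *\<^sub>R v) = 0" "z \<in> I" "u (e z) \<noteq> 0"
    then show False
      using zero[of "\<lambda>z. u (e z)" z] by (simp add: sum.reindex[OF inj])
  qed
qed

lemma finite_basis:
  assumes "is_basis B W" "\<exists>S. finite S \<and> W \<subseteq> span S"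
  shows "finite B"
proof -
  obtain S where "finite S" "W \<subseteq> span S"
    using assms(2) by blast
  moreover have "B \<subseteq> W"
    using assms(1) span_superset by (auto simp: is_basis_def)
  ultimately show ?thesis
    using assms(1) independent_span_bound[of S B] by (auto simp: is_basis_def)
qed

section \<open>Polynomial functions\<close>

lemma restr_UNIV [simp]: "restr UNIV f = f"
  by (simp add: restr_def)

lemma restr_apply: "restr \<omega> f y = (if y \<in> \<omega> then f y else 0)"
  by (simp add: restr_def)

lemma linear_restr: "linear (restr \<omega>)"
  by (auto simp: linear_iff restr_def fun_eq_iff scaleR_fun_def)

abbreviation polys :: "nat \<Rightarrow> (real^3 \<Rightarrow> 'b::real_vector) set"
  where "polys m \<equiv> poly_space m UNIV"

lemma poly_space_eq_restr: "poly_space m \<omega> = restr \<omega> ` polys m"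
proof -
  let ?M = "{restr UNIV (\<lambda>y. (\<Prod>d\<in>UNIV. y $ d ^ a d) *\<^sub>R c) | (a :: 3 \<Rightarrow> nat) (c::'a).
    (\<Sum>d\<in>UNIV. a d) \<le> m}"
  have "restr \<omega> ` ?M =
    {restr \<omega> (\<lambda>y. (\<Prod>d\<in>UNIV. y $ d ^ a d) *\<^sub>R c) | (a :: 3 \<Rightarrow> nat) c. (\<Sum>d\<in>UNIV. a d) \<le> m}"
    by (auto simp: image_iff; blast)
  then show ?thesis
    using linear_span_image[OF linear_restr, of \<omega> ?M] unfolding poly_space_def by simp
qed

lemma poly_spaceI: "p \<in> polys m \<Longrightarrow> restr \<omega> p \<in> poly_space m \<omega>"
  by (subst poly_space_eq_restr) (rule imageI)

lemma poly_spaceE: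
  assumes "p \<in> poly_space m \<omega>"
  obtains q where "q \<in> polys m" "p = restr \<omega> q"
proof -
  from assms have "p \<in> restr \<omega> ` polys m"
    by (subst (asm) poly_space_eq_restr)
  then show ?thesis
    using that by (elim imageE)
qed

lemma subspace_poly_space: "subspace (poly_space m \<omega>)"
  unfolding poly_space_def by (rule subspace_span)

lemma poly_space_mono: "m \<le> n \<Longrightarrow> poly_space m \<omega> \<subseteq> poly_space n \<omega>"
  unfolding poly_space_def by (rule span_mono) force

lemma polys_monomial:
  "(\<Sum>d\<in>UNIV. a d) \<le> m \<Longrightarrow> (\<lambda>y. (\<Prod>d\<in>UNIV. y $ d ^ a d) *\<^sub>R c) \<in> polys m"
  unfolding poly_space_def by (rule span_base) (auto intro!: exI[of _ a] exI[of _ c])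

lemma polys_const: "(\<lambda>y. c) \<in> polys m"
  using polys_monomial[of "\<lambda>_. 0" m c] by simp

lemma polys_add: "p \<in> polys m \<Longrightarrow> q \<in> polys m \<Longrightarrow> (\<lambda>y. p y + q y) \<in> polys m"
  using subspace_add[OF subspace_poly_space, of p m UNIV q] by (simp add: plus_fun_def)

lemma polys_scaleR: "p \<in> polys m \<Longrightarrow> (\<lambda>y. c *\<^sub>R p y) \<in> polys m"
  using subspace_scale[OF subspace_poly_space, of p m UNIV c] by (simp add: scaleR_fun_def)

lemma polys_cmult: "p \<in> polys m \<Longrightarrow> (\<lambda>y. c * p y) \<in> polys m"
  for p :: "real^3 \<Rightarrow> real"
  using polys_scaleR[of p m c] by simp

lemma polys_diff: "p \<in> polys m \<Longrightarrow> q \<in> polys m \<Longrightarrow> (\<lambda>y. p y - q y) \<in> polys m"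
  using polys_add[OF _ polys_scaleR[of q m "-1"], of p] by simp

lemma polys_sum:
  "(\<And>i. i \<in> I \<Longrightarrow> p i \<in> polys m) \<Longrightarrow> (\<lambda>y. \<Sum>i\<in>I. p i y) \<in> polys m"
  by (induction I rule: infinite_finite_induct) (simp_all add: polys_const polys_add)

lemma polys_mono: "p \<in> polys m \<Longrightarrow> m \<le> n \<Longrightarrow> p \<in> polys n"
  using poly_space_mono[of m n UNIV] by blast

lemma monomial_times_coord:
  "y $ d * (\<Prod>e\<in>UNIV. y $ e ^ a e) = (\<Prod>e\<in>UNIV. y $ e ^ (a(d := Suc (a d))) e)"
  for y :: "real^'n" and a :: "'n \<Rightarrow> nat"
proof -
  have "(\<Prod>e\<in>UNIV. y $ e ^ (a(d := Suc (a d))) e)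
      = (\<Prod>e\<in>UNIV. (if e = d then y $ d else 1) * y $ e ^ a e)"
    by (rule prod.cong) auto
  then show ?thesis
    by (simp add: prod.distrib)
qed

lemma sum_fun_upd_Suc: "(\<Sum>e\<in>UNIV. (a(d := Suc (a d))) e) = Suc (\<Sum>e\<in>UNIV. a e)"
  for a :: "'n::finite \<Rightarrow> nat"
proof -
  have "(\<Sum>e\<in>UNIV. (a(d := Suc (a d))) e) = (\<Sum>e\<in>UNIV. (if e = d then 1 else 0) + a e)"
    by (rule sum.cong) auto
  then show ?thesis
    by (simp add: sum.distrib)
qed

lemma polys_coord_mult: "p \<in> polys m \<Longrightarrow> (\<lambda>y. y $ d * p y) \<in> polys (Suc m)"
  for p :: "real^3 \<Rightarrow> real"
  unfolding poly_space_def[of m]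
proof (induction rule: span_induct_alt)
  case base
  show ?case using polys_const[of 0 "Suc m"] by (simp add: zero_fun_def)
next
  case (step c b q)
  then obtain a e where b: "b = (\<lambda>y. (\<Prod>d\<in>UNIV. y $ d ^ a d) *\<^sub>R e)"
    and a: "(\<Sum>d\<in>UNIV. a d) \<le> m"
    by auto
  have "(\<lambda>y. y $ d * b y) = (\<lambda>y. (\<Prod>e\<in>UNIV. y $ e ^ (a(d := Suc (a d))) e) *\<^sub>R e)"
    unfolding b monomial_times_coord[symmetric] by (simp add: mult.assoc)
  also have "\<dots> \<in> polys (Suc m)"
    using a by (intro polys_monomial) (simp only: sum_fun_upd_Suc Suc_le_mono)
  finally have "(\<lambda>y. c * (y $ d * b y) + y $ d * q y) \<in> polys (Suc m)"
    using step by (intro polys_add polys_cmult)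
  then show ?case
    by (simp add: plus_fun_def scaleR_fun_def algebra_simps)
qed

text \<open>
  All polynomials arise from the constants by sums and by multiplications with a coordinate
  function; tracking the degree bound along the way replaces computations with monomials by
  inductions of three easy cases.
\<close>

lemma polys_induct [consumes 1, case_names const add mult]:
  fixes p :: "real^3 \<Rightarrow> real"
  assumes "p \<in> polys m"
    and const: "\<And>m c. Q m (\<lambda>y. c)"
    and add: "\<And>m p q. p \<in> polys m \<Longrightarrow> q \<in> polys m \<Longrightarrow> Q m p \<Longrightarrow> Q m q \<Longrightarrow> Q m (\<lambda>y. p y + q y)"
    and mult: "\<And>m p d. p \<in> polys m \<Longrightarrow> Q m p \<Longrightarrow> Q (Suc m) (\<lambda>y. y $ d * p y)"
  shows "Q m p"
proof -
  have mon: "Q m (\<lambda>y. (\<Prod>d\<in>UNIV. y $ d ^ a d) *\<^sub>R c)" if "(\<Sum>d\<in>UNIV. a d) \<le> m" for a c m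
    using that
  proof (induction m arbitrary: a)
    case 0
    then show ?case using const[of 0 c] by simp
  next
    case (Suc m)
    show ?case
    proof (cases "\<exists>d. a d \<noteq> 0")
      case False
      then show ?thesis using const[of "Suc m" c] by simp
    next
      case True
      then obtain d where d: "a d \<noteq> 0" by blast
      define a' where "a' = a(d := a d - 1)"
      have a: "a = a'(d := Suc (a' d))"
        using d by (auto simp: a'_def)
      have le: "(\<Sum>d\<in>UNIV. a' d) \<le> m"
        using Suc.prems by (subst (asm) a) (simp only: sum_fun_upd_Suc Suc_le_mono)
      have "Q (Suc m) (\<lambda>y. y $ d * ((\<Prod>d\<in>UNIV. y $ d ^ a' d) *\<^sub>R c))"
        by (rule mult[OF polys_monomial[OF le] Suc.IH[OF le]])
      then show ?thesis
        by (subst a) (simp only: monomial_times_coord[symmetric] real_scaleR_def mult.assoc)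
    qed
  qed
  from assms(1) have "p \<in> polys m \<and> Q m p"
    unfolding poly_space_def[of m UNIV]
  proof (induction rule: span_induct_alt)
    case base
    show ?case using const[of m 0] by (simp only: zero_fun_def[symmetric] span_zero simp_thms)
  next
    case (step c b q)
    then obtain a e where b: "b = (\<lambda>y. (\<Prod>d\<in>UNIV. y $ d ^ a d) *\<^sub>R e)"
      and a: "(\<Sum>d\<in>UNIV. a d) \<le> m"
      by auto
    have eq: "c *\<^sub>R b + q = (\<lambda>y. (\<Prod>d\<in>UNIV. y $ d ^ a d) *\<^sub>R (c * e) + q y)"
      by (simp add: b plus_fun_def scaleR_fun_def mult_ac)
    have q: "q \<in> polys m" "Q m q"
      using step(2) by (simp_all add: poly_space_def[of m UNIV])
    have "c *\<^sub>R b + q \<in> polys m \<and> Q m (c *\<^sub>R b + q)"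
      unfolding eq using add[OF polys_monomial[OF a] q(1) mon[OF a] q(2)]
        polys_add[OF polys_monomial[OF a] q(1)] by (rule conjI[rotated])
    then show ?case
      by (simp only: poly_space_def)
  qed
  then show ?thesis by simp
qed

lemma polys_mult:
  fixes p q :: "real^3 \<Rightarrow> real"
  assumes "p \<in> polys m" "q \<in> polys n"
  shows "(\<lambda>y. p y * q y) \<in> polys (m + n)"
  using assms(1)
proof (induction rule: polys_induct)
  case (const m c)
  show ?case using polys_mono[OF polys_cmult[OF assms(2)], of "m + n" c] by simp
next
  case (add m p p')
  then show ?case using polys_add by (simp add: distrib_right)
next
  case (mult m p d)
  then show ?case using polys_coord_mult[of _ "m + n" d] by (simp add: mult.assoc)
qed

lemma polys_affine:
  fixes f :: "real^3 \<Rightarrow> real"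
  assumes "\<And>y. f y = c + g \<bullet> y"
  shows "f \<in> polys (Suc m)"
proof -
  have "(\<lambda>y. c + (\<Sum>d\<in>UNIV. g $ d * (y $ d * 1))) \<in> polys (Suc m)"
    by (intro polys_add polys_sum polys_cmult polys_coord_mult polys_const)
  also have "(\<lambda>y. c + (\<Sum>d\<in>UNIV. g $ d * (y $ d * 1))) = f"
    by (auto simp: assms inner_vec_def)
  finally show ?thesis .
qed

lemma polys_compose_affine:
  fixes p :: "real^3 \<Rightarrow> real" and A :: "real^3 \<Rightarrow> real^3"
  assumes "p \<in> polys m" and A: "\<And>d m. (\<lambda>y. A y $ d) \<in> polys (Suc m)"
  shows "(\<lambda>y. p (A y)) \<in> polys m"
  using assms(1)
proof (induction rule: polys_induct)
  case (mult m p d)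
  then show ?case using polys_mult[OF A[of d 0] mult(2)] by simp
qed (auto intro: polys_const polys_add)

lemma polys_power: "p \<in> polys (Suc 0) \<Longrightarrow> (\<lambda>y. p y ^ n) \<in> polys n"
  for p :: "real^3 \<Rightarrow> real"
proof (induction n)
  case 0
  show ?case using polys_const[of 1 0] by simp
next
  case (Suc n)
  then show ?case using polys_mult[of p "Suc 0" "\<lambda>y. p y ^ n" n] by simp
qed

lemma polys_times_const: "p \<in> polys m \<Longrightarrow> (\<lambda>y. p y *\<^sub>R c) \<in> polys m"
  for p :: "real^3 \<Rightarrow> real"
  unfolding poly_space_def[of m, where 'b = real]
proof (induction rule: span_induct_alt)
  case base
  show ?case using polys_const[of 0 m] by (simp add: zero_fun_def)
next
  case (step e b q)
  then obtain a f where b: "b = (\<lambda>y. (\<Prod>d\<in>UNIV. y $ d ^ a d) *\<^sub>R f)"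
    and a: "(\<Sum>d\<in>UNIV. a d) \<le> m"
    by auto
  have "(\<lambda>y. (\<Prod>d\<in>UNIV. y $ d ^ a d) *\<^sub>R ((e * f) *\<^sub>R c) + q y *\<^sub>R c) \<in> polys m"
    using step a by (intro polys_add polys_monomial)
  then show ?case
    by (simp add: b plus_fun_def scaleR_fun_def scaleR_add_left mult_ac)
qed

lemma polys_inner: "p \<in> polys m \<Longrightarrow> (\<lambda>y. g \<bullet> p y) \<in> polys m"
  for p :: "real^3 \<Rightarrow> 'b::real_inner"
  unfolding poly_space_def[of m, where 'b = 'b]
proof (induction rule: span_induct_alt)
  case base
  show ?case using polys_const[of 0 m] by (simp add: zero_fun_def)
next
  case (step e b q)
  then obtain a f where b: "b = (\<lambda>y. (\<Prod>d\<in>UNIV. y $ d ^ a d) *\<^sub>R f)"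
    and a: "(\<Sum>d\<in>UNIV. a d) \<le> m"
    by auto
  have "(\<lambda>y. (\<Prod>d\<in>UNIV. y $ d ^ a d) *\<^sub>R (e * (g \<bullet> f)) + g \<bullet> q y) \<in> polys m"
    using step a by (intro polys_add polys_monomial)
  then show ?case
    by (simp add: b plus_fun_def scaleR_fun_def inner_add_right mult_ac)
qed

lemma continuous_on_poly_space: "p \<in> poly_space m \<omega> \<Longrightarrow> continuous_on \<omega> p"
  for p :: "real^3 \<Rightarrow> 'b::real_normed_vector"
  unfolding poly_space_def
proof (induction rule: span_induct_alt)
  case base
  show ?case by (simp add: zero_fun_def)
next
  case (step c b q)
  then obtain a e where b: "b = restr \<omega> (\<lambda>y. (\<Prod>d\<in>UNIV. y $ d ^ a d) *\<^sub>R e)"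
    by auto
  have "continuous_on \<omega> (\<lambda>y. c *\<^sub>R (\<Prod>d\<in>UNIV. y $ d ^ a d) *\<^sub>R e + q y)"
    using step(2) by (intro continuous_intros)
  then show ?case
    by (rule continuous_on_eq) (simp add: b restr_apply plus_fun_def scaleR_fun_def)
qed

text \<open>
  Moving the argument by a multiple \<open>\<lambda>(y)\<close> of a fixed vector changes the value of a
  polynomial by a multiple of \<open>\<lambda>(y)\<close>: if \<open>\<lambda>\<close> is affine, this is division of a polynomial
  that vanishes on a plane by the equation of the plane. The conclusion for \<open>m = 0\<close> makes up for
  the truncated subtraction in the degree.
\<close>

lemma polys_shift_factor:
  fixes p lam :: "real^3 \<Rightarrow> real" and t :: "real^3"
  assumes "p \<in> polys m" and lam: "\<And>m. lam \<in> polys (Suc m)"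
  shows "\<exists>q \<in> polys (m - 1). (m = 0 \<longrightarrow> q = (\<lambda>y. 0)) \<and>
           (\<forall>y. p y = p (y + lam y *\<^sub>R t) + lam y * q y)"
  using assms(1)
proof (induction rule: polys_induct)
  case (const m c)
  show ?case by (rule bexI[of _ "\<lambda>y. 0"]) (auto intro: polys_const)
next
  case (add m p p')
  from add(3) obtain q where q: "q \<in> polys (m - 1)" "m = 0 \<longrightarrow> q = (\<lambda>y. 0)"
    "\<forall>y. p y = p (y + lam y *\<^sub>R t) + lam y * q y"
    by blast
  from add(4) obtain q' where q': "q' \<in> polys (m - 1)" "m = 0 \<longrightarrow> q' = (\<lambda>y. 0)"
    "\<forall>y. p' y = p' (y + lam y *\<^sub>R t) + lam y * q' y"
    by blast
  have "p y + p' y = p (y + lam y *\<^sub>R t) + p' (y + lam y *\<^sub>R t) + lam y * (q y + q' y)" for y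
    using q(3)[rule_format, of y] q'(3)[rule_format, of y] by (simp add: distrib_left)
  moreover have "m = 0 \<longrightarrow> (\<lambda>y. q y + q' y) = (\<lambda>y. 0)"
    using q(2) q'(2) by simp
  ultimately show ?case
    using polys_add[OF q(1) q'(1)] by (intro bexI[of _ "\<lambda>y. q y + q' y"] conjI allI)
next
  case (mult m p d)
  then obtain q where q: "q \<in> polys (m - 1)" "m = 0 \<longrightarrow> q = (\<lambda>y. 0)"
    "\<forall>y. p y = p (y + lam y *\<^sub>R t) + lam y * q y"
    by blast
  have "(\<lambda>y. y $ d + t $ d * lam y) \<in> polys (Suc 0)"
  proof (intro polys_add polys_cmult lam)
    show "(\<lambda>y. y $ d) \<in> polys (Suc 0)"
      by (rule polys_affine[of _ 0 "axis d 1"]) (simp add: inner_axis')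
  qed
  then have "(\<lambda>y. (y $ d + t $ d * lam y) * q y) \<in> polys m"
    using polys_mult[OF _ q(1), of _ "Suc 0"] q(2) by (cases m) (auto intro: polys_const)
  then have "(\<lambda>y. (y $ d + t $ d * lam y) * q y - t $ d * p y) \<in> polys (Suc m - 1)"
    using polys_diff[OF _ polys_cmult[OF mult(1)]] by simp
  moreover have "y $ d * p y = (y + lam y *\<^sub>R t) $ d * p (y + lam y *\<^sub>R t) +
      lam y * ((y $ d + t $ d * lam y) * q y - t $ d * p y)" for y
  proof -
    have "p (y + lam y *\<^sub>R t) = p y - lam y * q y"
      using q(3)[rule_format, of y] by linarith
    then show ?thesis
      by (simp only:) (simp add: algebra_simps)
  qed
  ultimately show ?case
    by (intro bexI[of _ "\<lambda>y. (y $ d + t $ d * lam y) * q y - t $ d * p y"] conjI allI) simp_all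
qed

text \<open>
  A monomial may carry any coefficient vector; expanding the vectors in a basis leaves finitely many
  generators.
\<close>

lemma poly_space_finitely_spanned:
  "\<exists>S. finite S \<and> (poly_space m \<omega> :: (real^3 \<Rightarrow> 'b::euclidean_space) set) \<subseteq> span S"
proof -
  let ?A = "{a :: 3 \<Rightarrow> nat. (\<Sum>d\<in>UNIV. a d) \<le> m}"
  let ?f = "\<lambda>(a::3 \<Rightarrow> nat, b::'b). restr \<omega> (\<lambda>y. (\<Prod>d\<in>UNIV. y $ d ^ a d) *\<^sub>R b)"
  let ?S = "?f ` (?A \<times> Basis)"
  have "?A \<subseteq> (UNIV :: 3 set) \<rightarrow>\<^sub>E {..m}"
  proof
    fix a :: "3 \<Rightarrow> nat" assume "a \<in> ?A"
    then have a: "(\<Sum>d\<in>UNIV. a d) \<le> m" by simp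
    have "a d \<le> m" for d
      using member_le_sum[of d UNIV a] a by simp
    then show "a \<in> UNIV \<rightarrow>\<^sub>E {..m}" by auto
  qed
  then have fin: "finite ?S"
    by (intro finite_imageI finite_cartesian_product) (auto intro!: finite_PiE elim!: finite_subset)
  have "restr \<omega> (\<lambda>y. (\<Prod>d\<in>UNIV. y $ d ^ a d) *\<^sub>R c) \<in> span ?S"
    if "(\<Sum>d\<in>UNIV. a d) \<le> m" for a :: "3 \<Rightarrow> nat" and c :: 'b
  proof -
    have "(\<Sum>b\<in>Basis. (c \<bullet> b) *\<^sub>R ?f (a, b)) \<in> span ?S"
      using that by (intro span_sum span_scale span_base) auto
    also have "(\<Sum>b\<in>Basis. (c \<bullet> b) *\<^sub>R ?f (a, b)) = restr \<omega> (\<lambda>y. (\<Prod>d\<in>UNIV. y $ d ^ a d) *\<^sub>R c)"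
    proof
      fix y
      have app: "(\<Sum>b\<in>T. F b) y = (\<Sum>b\<in>T. F b y)" for F :: "'b \<Rightarrow> real^3 \<Rightarrow> 'b" and T
        by (induction T rule: infinite_finite_induct) auto
      show "(\<Sum>b\<in>Basis. (c \<bullet> b) *\<^sub>R ?f (a, b)) y =
          restr \<omega> (\<lambda>y. (\<Prod>d\<in>UNIV. y $ d ^ a d) *\<^sub>R c) y"
        using arg_cong[OF euclidean_representation[of c], of "\<lambda>v. (\<Prod>d\<in>UNIV. y $ d ^ a d) *\<^sub>R v"]
        by (simp add: app restr_apply scaleR_fun_def scaleR_sum_right mult.commute)
    qed
    finally show ?thesis .
  qed
  then have "poly_space m \<omega> \<subseteq> span ?S"
    unfolding poly_space_def by (intro span_minimal subspace_span) auto
  with fin show ?thesis by blast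
qed

section \<open>Integrals of continuous functions\<close>

lemma set_integrable_compact:
  fixes f :: "'a::euclidean_space \<Rightarrow> real"
  assumes "compact S" "continuous_on S f"
  shows "set_integrable lborel S f"
  using borel_integrable_compact[OF assms] by (simp add: set_integrable_def indicator_def if_distrib cong: if_cong)

text \<open>
  The positivity argument for all three uniqueness steps. The weight may vanish on the boundary, as the
  distance to an edge does; this is harmless because a convex set with interior points is the closure of its
  interior.
\<close>

lemma set_integral_weighted_square_zero:
  fixes f w :: "'a::euclidean_space \<Rightarrow> real"
  assumes S: "compact S" "convex S" "interior S \<noteq> {}"
    and cont: "continuous_on S f" "continuous_on S w"
    and w: "\<And>y. y \<in> S \<Longrightarrow> w y \<ge> 0" "\<And>y. y \<in> interior S \<Longrightarrow> w y > 0"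
    and int: "(LINT y:S|lborel. w y * (f y)\<^sup>2) = 0"
    and y: "y \<in> S"
  shows "f y = 0"
proof -
  let ?g = "\<lambda>y. w y * (f y)\<^sup>2"
  have "set_integrable lborel S ?g"
    using S(1) cont by (intro set_integrable_compact continuous_intros)
  then have "AE y in lborel. indicator S y *\<^sub>R ?g y = 0"
    using int w(1) unfolding set_lebesgue_integral_def set_integrable_def
    by (subst integral_nonneg_eq_0_iff_AE[symmetric]) (auto simp: indicator_def)
  then obtain N where N: "{y. indicator S y *\<^sub>R ?g y \<noteq> 0} \<subseteq> N" "N \<in> null_sets lborel"
    unfolding eventually_ae_filter by (auto simp: null_sets_def)
  let ?U = "interior S \<inter> f -` (- {0})"
  have "open ?U"
    by (rule continuous_open_preimage[OF continuous_on_subset[OF cont(1) interior_subset]]) auto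
  have sub: "?U \<subseteq> {y. indicator S y *\<^sub>R ?g y \<noteq> 0}"
  proof
    fix z assume "z \<in> ?U"
    then show "z \<in> {y. indicator S y *\<^sub>R ?g y \<noteq> 0}"
      using w(2)[of z] interior_subset[of S] by (auto simp: indicator_def)
  qed
  have "negligible N"
    using N(2) by (auto simp: negligible_iff_null_sets intro: null_sets_completionI)
  then have "negligible ?U"
    using sub N(1) negligible_subset by blast
  then have "?U = {}"
    using open_not_negligible[OF \<open>open ?U\<close>] by blast
  then have zero: "f z = 0" if "z \<in> interior S" for z
    using that by auto
  have "y \<in> closure (interior S)"
    using convex_closure_interior[OF S(2,3)] y closure_subset by blast
  then show "f y = 0"
  proof -
    have "closure (interior S) \<subseteq> S"
      using S(1) by (simp add: closure_minimal compact_imp_closed interior_subset)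
    then have "continuous_on (closure (interior S)) f"
      using cont(1) continuous_on_subset by blast
    from continuous_constant_on_closure[OF this zero] \<open>y \<in> closure (interior S)\<close>
    show ?thesis by blast
  qed
qed

definition ref_triangle :: "(real \<times> real) set"
  where "ref_triangle = {(s, t). 0 \<le> s \<and> 0 \<le> t \<and> s + t \<le> 1}"

lemma ref_triangle_eq:
  "ref_triangle = {p. (- 1, 0) \<bullet> p \<le> 0} \<inter> {p. (0, - 1) \<bullet> p \<le> 0} \<inter> {p. (1, 1) \<bullet> p \<le> 1}"
  by (auto simp: ref_triangle_def)

lemma convex_ref_triangle: "convex ref_triangle"
  unfolding ref_triangle_eq by (intro convex_Int convex_halfspace_le)

lemma compact_ref_triangle: "compact ref_triangle"
proof -
  have "closed ref_triangle"
    unfolding ref_triangle_eq by (intro closed_Int closed_halfspace_le)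
  moreover have "ref_triangle \<subseteq> cbox (0, 0) (1, 1)"
    by (auto simp: ref_triangle_def cbox_Pair_eq)
  ultimately show ?thesis
    by (meson bounded_cbox bounded_subset compact_eq_bounded_closed)
qed

lemma interior_ref_triangle: "interior ref_triangle = {(s, t). 0 < s \<and> 0 < t \<and> s + t < 1}"
  unfolding ref_triangle_eq interior_Int
  by (subst interior_halfspace_le, simp add: zero_prod_def)+ (auto simp: zero_prod_def)

lemma interior_ref_triangle_nonempty: "interior ref_triangle \<noteq> {}"
proof -
  have "(1/3, 1/3) \<in> interior ref_triangle"
    by (simp add: interior_ref_triangle)
  then show ?thesis by blast
qed

text \<open>
  The swap and the following shear permute the vertices of the reference triangle and generate all
  its permutations. Both preserve Lebesgue measure.
\<close>

lemma ref_triangle_integral_swap: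
  fixes f :: "real \<times> real \<Rightarrow> real"
  assumes "continuous_on ref_triangle f"
  shows "(LINT p:ref_triangle|lborel. f (snd p, fst p)) = (LINT p:ref_triangle|lborel. f p)"
proof -
  let ?F = "\<lambda>p. indicator ref_triangle p *\<^sub>R f p"
  have int: "integrable (lborel \<Otimes>\<^sub>M lborel) ?F"
    using set_integrable_compact[OF compact_ref_triangle assms]
    by (simp add: set_integrable_def lborel_prod case_prod_beta')
  have "(LINT p|(lborel \<Otimes>\<^sub>M lborel). ?F p)
      = (LINT p|(lborel \<Otimes>\<^sub>M lborel). (case p of (s, t) \<Rightarrow> ?F (t, s)))"
    using lborel_pair.integral_product_swap[of ?F] int by (simp add: borel_measurable_integrable)
  also have "(\<lambda>p. case p of (s, t) \<Rightarrow> ?F (t, s))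
      = (\<lambda>p. indicator ref_triangle p *\<^sub>R f (snd p, fst p))"
    by (auto simp: ref_triangle_def indicator_def fun_eq_iff add.commute)
  finally show ?thesis
    by (simp add: set_lebesgue_integral_def lborel_prod)
qed

lemma ref_triangle_integral_shear:
  fixes f :: "real \<times> real \<Rightarrow> real"
  assumes "continuous_on ref_triangle f"
  shows "(LINT p:ref_triangle|lborel. f (1 - fst p - snd p, snd p)) = (LINT p:ref_triangle|lborel. f p)"
proof -
  let ?F = "\<lambda>p. indicator ref_triangle p *\<^sub>R f p"
  let ?G = "\<lambda>p. indicator ref_triangle p *\<^sub>R f (1 - fst p - snd p, snd p)"
  have int: "integrable (lborel \<Otimes>\<^sub>M lborel) (\<lambda>(s, t). ?F (s, t))"
    using set_integrable_compact[OF compact_ref_triangle assms]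
    by (simp add: set_integrable_def lborel_prod case_prod_beta')
  have "continuous_on ref_triangle (\<lambda>p. f (1 - fst p - snd p, snd p))"
    by (rule continuous_on_compose2[OF assms]) (auto intro!: continuous_intros simp: ref_triangle_def)
  then have int': "integrable (lborel \<Otimes>\<^sub>M lborel) (\<lambda>(s, t). ?G (s, t))"
    using set_integrable_compact[OF compact_ref_triangle]
    by (simp add: set_integrable_def lborel_prod case_prod_beta')
  have eq: "?G (s, t) = ?F ((1 - t) + (- 1) * s, t)" for s t
    by (auto simp: ref_triangle_def indicator_def algebra_simps)
  have "(LINT p|(lborel \<Otimes>\<^sub>M lborel). ?G p) = (LINT t|lborel. LINT s|lborel. ?G (s, t))"
    using lborel_pair.integral_snd[OF int'] by (simp add: case_prod_beta')
  also have "\<dots> = (LINT t|lborel. LINT s|lborel. ?F (s, t))"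
    unfolding eq using lborel_integral_real_affine[of "-1" "\<lambda>s. ?F (s, _)"] by simp
  also have "\<dots> = (LINT p|(lborel \<Otimes>\<^sub>M lborel). ?F p)"
    using lborel_pair.integral_snd[OF int] by (simp add: case_prod_beta')
  finally show ?thesis
    by (simp add: set_lebesgue_integral_def lborel_prod)
qed

definition tri_param :: "'a::real_vector \<Rightarrow> 'a \<Rightarrow> 'a \<Rightarrow> real \<times> real \<Rightarrow> 'a"
  where "tri_param a b c p = a + fst p *\<^sub>R (b - a) + snd p *\<^sub>R (c - a)"

lemma tri_param_in_hull: "p \<in> ref_triangle \<Longrightarrow> tri_param a b c p \<in> convex hull {a, b, c}"
proof -
  assume "p \<in> ref_triangle"
  moreover have "tri_param a b c p = (1 - fst p - snd p) *\<^sub>R a + fst p *\<^sub>R b + snd p *\<^sub>R c"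
    by (simp add: tri_param_def algebra_simps)
  ultimately show ?thesis
    unfolding convex_hull_3 ref_triangle_def by force
qed

lemma continuous_on_tri_param:
  fixes a b c :: "'a::real_normed_vector"
  assumes "continuous_on (convex hull {a, b, c}) f"
  shows "continuous_on ref_triangle (\<lambda>p. f (tri_param a b c p))"
  by (rule continuous_on_compose2[OF assms])
    (auto simp: tri_param_in_hull tri_param_def[abs_def] simp del: split_paired_All
      intro!: continuous_intros tri_param_in_hull[unfolded tri_param_def, of "(_, _)", simplified])

definition tri_area :: "real^3 \<Rightarrow> real^3 \<Rightarrow> real^3 \<Rightarrow> real"
  where "tri_area a b c = norm (cross3 (b - a) (c - a))"

lemma triangle_integral_eq:
  "triangle_integral a b c f =
     tri_area a b c * (LINT p:ref_triangle|lborel. f (tri_param a b c p))"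
proof -
  have "(\<lambda>(s, t). f (a + s *\<^sub>R (b - a) + t *\<^sub>R (c - a)) * norm (cross3 (b - a) (c - a)))
      = (\<lambda>p. tri_area a b c * f (tri_param a b c p))"
    by (auto simp: tri_param_def tri_area_def)
  then show ?thesis
    unfolding triangle_integral_def ref_triangle_def[symmetric] by simp
qed

lemma triangle_integral_swap_23:
  assumes "continuous_on (convex hull {a, b, c}) f"
  shows "triangle_integral a c b f = triangle_integral a b c f"
proof -
  have "tri_area a c b = tri_area a b c"
    unfolding tri_area_def by (subst cross_skew) simp
  moreover have "tri_param a c b p = tri_param a b c (snd p, fst p)" for p
    by (simp add: tri_param_def)
  ultimately show ?thesis
    using ref_triangle_integral_swap[OF continuous_on_tri_param[OF assms]]
    by (simp add: triangle_integral_eq)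
qed

lemma triangle_integral_swap_12:
  assumes "continuous_on (convex hull {a, b, c}) f"
  shows "triangle_integral b a c f = triangle_integral a b c f"
proof -
  have "cross3 (a - b) (c - b) = - cross3 (b - a) (c - a)"
    by (simp add: cross3_simps)
  then have "tri_area b a c = tri_area a b c"
    unfolding tri_area_def by simp
  moreover have "tri_param b a c p = tri_param a b c (1 - fst p - snd p, snd p)" for p
    by (simp add: tri_param_def algebra_simps)
  ultimately show ?thesis
    using ref_triangle_integral_shear[OF continuous_on_tri_param[OF assms]]
    by (simp add: triangle_integral_eq)
qed

text \<open>
  Two faces that share an edge are compared below in parametrizations that agree on this edge; these need
  not be the parametrizations by increasing vertex indices.
\<close>

lemma triangle_integral_perm:
  assumes "continuous_on (convex hull {a, b, c}) f" "{a', b', c'} = {a, b, c}" "card {a, b, c} = 3"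
  shows "triangle_integral a' b' c' f = triangle_integral a b c f"
proof -
  have d: "a \<noteq> b" "a \<noteq> c" "b \<noteq> c"
    using assms(3) by (auto simp: card_insert_if split: if_splits)
  have h: "{a,c,b} = {a,b,c}" "{b,a,c} = {a,b,c}" "{b,c,a} = {a,b,c}" "{c,a,b} = {a,b,c}" "{c,b,a} = {a,b,c}"
    by auto
  have "(a', b', c') \<in> {(a,b,c), (a,c,b), (b,a,c), (b,c,a), (c,a,b), (c,b,a)}"
    using assms(2) d by (simp add: set_eq_iff) metis
  moreover have "triangle_integral a c b f = triangle_integral a b c f"
    "triangle_integral b a c f = triangle_integral a b c f"
    "triangle_integral b c a f = triangle_integral b a c f"
    "triangle_integral c a b f = triangle_integral a c b f"
    "triangle_integral c b a f = triangle_integral b c a f"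
    by (intro triangle_integral_swap_12 triangle_integral_swap_23; simp only: h assms(1))+
  ultimately show ?thesis
    by auto
qed

section \<open>Barycentric coordinates\<close>

locale tetrahedron =
  fixes x :: "nat \<Rightarrow> real^3"
  assumes nondegenerate: "nondegenerate x"
begin

definition V :: "nat set" where "V = {1..4}"

lemma finite_V [simp]: "finite V"
  and card_V: "card V = 4"
  by (simp_all add: V_def)

lemmas bary_V = bary_def[where x = x, folded V_def]
  and tetra_V = tetra_def[where x = x, folded V_def]
  and face_V = face_def[where x = x, folded V_def]

lemma inj_x: "inj_on x V"
  and affine_independent_x: "\<not> affine_dependent (x ` V)"
  using nondegenerate by (auto simp: nondegenerate_def V_def)

lemma other_vertex: "\<exists>j\<in>V. j \<noteq> i"
  by (cases "i = 1") (auto simp: V_def intro: bexI[of _ 1] bexI[of _ 2])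

lemma bary_ex1:
  "\<exists>!l. (\<forall>j. j \<notin> V \<longrightarrow> l j = (0::real)) \<and> (\<Sum>j\<in>V. l j) = 1 \<and> (\<Sum>j\<in>V. l j *\<^sub>R x j) = y"
proof -
  note inj = inj_x and indep = affine_independent_x
  have "affine hull (x ` V) = UNIV"
    using indep by (rule affine_independent_span_eq) (simp add: card_image[OF inj] card_V)
  then obtain u where u: "sum u (x ` V) = 1" "(\<Sum>v\<in>x ` V. u v *\<^sub>R v) = y"
    using affine_hull_finite[of "x ` V"] by (auto simp: set_eq_iff)
  show ?thesis
  proof (rule ex1I[of _ "\<lambda>j. if j \<in> V then u (x j) else 0"], goal_cases)
    case 1
    show ?case using u by (simp add: sum.reindex[OF inj] cong: sum.cong)
  next
    case (2 l)
    define d where "d j = l j - (if j \<in> V then u (x j) else 0)" for j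
    let ?U = "\<lambda>v. d (the_inv_into V x v)"
    have inv: "?U (x j) = d j" if "j \<in> V" for j
      using the_inv_into_f_f[OF inj that] by simp
    have "sum d V = 0" "(\<Sum>j\<in>V. d j *\<^sub>R x j) = 0"
      using 2 u by (simp_all add: sum.reindex[OF inj] d_def sum_subtractf scaleR_diff_left cong: sum.cong)
    then have "sum ?U (x ` V) = 0" "(\<Sum>v\<in>x ` V. ?U v *\<^sub>R v) = 0"
      by (simp_all add: sum.reindex[OF inj] inv cong: sum.cong)
    then have "\<forall>v\<in>x ` V. ?U v = 0"
      using indep by (subst (asm) affine_dependent_explicit_finite) auto
    then have "d j = 0" if "j \<in> V" for j
      using inv that by auto
    then show ?case
      using 2 by (auto simp: fun_eq_iff d_def)
  qed
qed

lemma
  shows sum_bary: "(\<Sum>j\<in>V. bary x j y) = 1"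
    and sum_bary_scaleR: "(\<Sum>j\<in>V. bary x j y *\<^sub>R x j) = y"
  using theI'[OF bary_ex1[of y]] unfolding bary_V by auto

lemma bary_unique:
  assumes "(\<Sum>j\<in>V. l j) = 1" "(\<Sum>j\<in>V. l j *\<^sub>R x j) = y" "i \<in> V"
  shows "bary x i y = l i"
proof -
  let ?l = "\<lambda>j. if j \<in> V then l j else 0"
  have "(\<Sum>j\<in>V. ?l j) = 1" "(\<Sum>j\<in>V. ?l j *\<^sub>R x j) = y"
    using assms by (simp_all cong: sum.cong)
  then have "(THE l. (\<forall>j. j \<notin> V \<longrightarrow> l j = 0) \<and> (\<Sum>j\<in>V. l j) = 1 \<and> (\<Sum>j\<in>V. l j *\<^sub>R x j) = y) = ?l"
    by (intro the1_equality[OF bary_ex1]) simp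
  then show ?thesis
    using assms(3) by (simp add: bary_V)
qed

text \<open>The gradient of the affine function \<open>bary x i\<close>.\<close>

definition grad :: "nat \<Rightarrow> real^3"
  where "grad i = (\<Sum>b\<in>Basis. (bary x i b - bary x i 0) *\<^sub>R b)"

lemma bary_affine:
  assumes "i \<in> V"
  shows "bary x i y = bary x i 0 + grad i \<bullet> y"
proof -
  let ?f = "\<lambda>y. bary x i y - bary x i 0"
  have comb: "bary x i (c *\<^sub>R y + z) = c * ?f y + bary x i z" for c y z
  proof -
    let ?l = "\<lambda>j. c * (bary x j y - bary x j 0) + bary x j z"
    have "(\<Sum>j\<in>V. ?l j) = 1"
      by (simp add: sum.distrib sum_bary sum_subtractf flip: sum_distrib_left)
    moreover have "(\<Sum>j\<in>V. ?l j *\<^sub>R x j) = c *\<^sub>R ((\<Sum>j\<in>V. bary x j y *\<^sub>R x j) - (\<Sum>j\<in>V. bary x j 0 *\<^sub>R x j))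
        + (\<Sum>j\<in>V. bary x j z *\<^sub>R x j)"
      by (simp only: scaleR_add_left scaleR_diff_left sum.distrib sum_subtractf scaleR_sum_right
          scaleR_scaleR[symmetric] scaleR_diff_right)
    ultimately show ?thesis
      by (intro bary_unique assms) (simp_all add: sum_bary_scaleR)
  qed
  have "linear ?f"
    using comb[of _ _ 0] comb[of 1] by (intro linearI) (auto simp: algebra_simps)
  then have "?f y = (\<Sum>b\<in>Basis. (y \<bullet> b) *\<^sub>R ?f b)"
    using linear_sum[of ?f "\<lambda>b. (y \<bullet> b) *\<^sub>R b" Basis] linear_scale[of ?f]
    by (simp add: euclidean_representation)
  also have "\<dots> = grad i \<bullet> y"
    by (simp add: grad_def inner_sum_left inner_commute[of y] mult.commute)
  finally show ?thesis
    by simp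
qed

lemma bary_add: "i \<in> V \<Longrightarrow> bary x i (y + w) = bary x i y + grad i \<bullet> w"
  using bary_affine[of i y] bary_affine[of i "y + w"] by (simp add: inner_right_distrib)

lemma bary_vertex: "i \<in> V \<Longrightarrow> j \<in> V \<Longrightarrow> bary x i (x j) = (if i = j then 1 else 0)"
  by (rule bary_unique) (simp_all add: if_distrib[of "\<lambda>c. c *\<^sub>R _"] cong: if_cong)

lemma grad_tangent:
  assumes "i \<in> V" "a \<in> V" "b \<in> V"
  shows "grad i \<bullet> tangent x a b = (if i = b then 1 else 0) - (if i = a then 1 else 0)"
  using bary_add[of i "x a" "tangent x a b"] assms by (simp add: tangent_def bary_vertex)

lemma vector_eq_sum_grad: "w = (\<Sum>j\<in>V. (grad j \<bullet> w) *\<^sub>R x j)"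
proof -
  have "w = (\<Sum>j\<in>V. bary x j w *\<^sub>R x j) - (\<Sum>j\<in>V. bary x j 0 *\<^sub>R x j)"
    by (simp add: sum_bary_scaleR)
  also have "\<dots> = (\<Sum>j\<in>V. (bary x j w - bary x j 0) *\<^sub>R x j)"
    by (simp only: scaleR_diff_left sum_subtractf)
  also have "\<dots> = (\<Sum>j\<in>V. (grad j \<bullet> w) *\<^sub>R x j)"
    using bary_affine[of _ w] by (intro sum.cong) auto
  finally show ?thesis .
qed

lemma sum_grad_inner: "(\<Sum>j\<in>V. grad j \<bullet> w) = 0"
proof -
  have "(\<Sum>j\<in>V. grad j \<bullet> w) = (\<Sum>j\<in>V. bary x j w - bary x j 0)"
    using bary_affine[of _ w] by (intro sum.cong) auto
  then show ?thesis
    by (simp add: sum_subtractf sum_bary)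
qed

text \<open>
  The four gradients add up to \<open>0\<close>, so any three of them already separate vectors.
\<close>

lemma vector_eqI_grad:
  assumes "i \<in> V" "\<And>j. j \<in> V - {i} \<Longrightarrow> grad j \<bullet> w = 0"
  shows "w = 0"
proof -
  have "grad i \<bullet> w = 0"
    using sum_grad_inner[of w] assms by (simp add: sum.remove[of V i])
  then have "grad j \<bullet> w = 0" if "j \<in> V" for j
    using assms that by blast
  then show ?thesis
    using vector_eq_sum_grad[of w] by simp
qed

lemma continuous_on_bary: "i \<in> V \<Longrightarrow> continuous_on S (bary x i)"
  by (subst continuous_on_cong[OF refl bary_affine]) (auto intro!: continuous_intros)

lemma tetra_eq: "tetra x = {y. \<forall>i\<in>V. 0 \<le> bary x i y}"
proof -
  note inj = inj_x
  show ?thesis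
  proof (intro set_eqI iffI; clarify?)
    fix y i assume "y \<in> tetra x" "i \<in> V"
    then obtain u where "\<forall>v\<in>x ` V. 0 \<le> u v" "sum u (x ` V) = 1" "(\<Sum>v\<in>x ` V. u v *\<^sub>R v) = y"
      unfolding tetra_V by (subst (asm) convex_hull_finite) auto
    then show "0 \<le> bary x i y"
      using bary_unique[of "u \<circ> x" y i] \<open>i \<in> V\<close> by (simp add: sum.reindex[OF inj])
  next
    fix y assume "\<forall>i\<in>V. 0 \<le> bary x i y"
    then have "(\<Sum>j\<in>V. bary x j y *\<^sub>R x j) \<in> convex hull (x ` V)"
      by (intro convex_sum) (auto simp: sum_bary intro: hull_inc)
    then show "y \<in> tetra x"
      by (simp add: sum_bary_scaleR tetra_V)
  qed
qed

lemma face_eq: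
  assumes "i \<in> V"
  shows "face x i = {y \<in> tetra x. bary x i y = 0}"
proof -
  have inj: "inj_on x (V - {i})"
    using inj_x by (rule inj_on_subset) blast
  show ?thesis
  proof (intro set_eqI iffI; clarify?)
    fix y assume y: "y \<in> face x i"
    then obtain u where u: "sum u (x ` (V - {i})) = 1" "(\<Sum>v\<in>x ` (V - {i}). u v *\<^sub>R v) = y"
      unfolding face_V by (subst (asm) convex_hull_finite) auto
    let ?l = "\<lambda>j. if j = i then 0 else u (x j)"
    have "(\<Sum>j\<in>V. ?l j) = 1" "(\<Sum>j\<in>V. ?l j *\<^sub>R x j) = y"
      using u assms by (simp_all add: sum.reindex[OF inj] sum.remove[of V i])
    then have "bary x i y = 0"
      using bary_unique[of ?l y i] assms by simp
    moreover have "y \<in> tetra x"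
      using y unfolding face_V tetra_V by (rule subsetD[OF hull_mono, rotated]) auto
    ultimately show "y \<in> tetra x \<and> bary x i y = 0" by simp
  next
    fix y assume y: "y \<in> tetra x" "bary x i y = 0"
    then have "(\<Sum>j\<in>V - {i}. bary x j y *\<^sub>R x j) \<in> convex hull (x ` (V - {i}))"
      using sum_bary[of y] assms
      by (intro convex_sum) (auto simp: tetra_eq sum.remove[of V i] intro: hull_inc)
    also have "(\<Sum>j\<in>V - {i}. bary x j y *\<^sub>R x j) = y"
      using sum_bary_scaleR[of y] y(2) assms by (simp add: sum.remove[of V i])
    finally show "y \<in> face x i"
      by (simp add: face_V)
  qed
qed

lemma face_subset_tetra: "i \<in> V \<Longrightarrow> face x i \<subseteq> tetra x"
  by (auto simp: face_eq)

lemma vertex_in_face: "i \<in> V \<Longrightarrow> j \<in> V \<Longrightarrow> i \<noteq> j \<Longrightarrow> x j \<in> face x i"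
  unfolding face_V by (auto intro: hull_inc)

lemma compact_tetra: "compact (tetra x)"
  unfolding tetra_V by (intro finite_imp_compact_convex_hull) simp

lemma convex_tetra: "convex (tetra x)"
  unfolding tetra_V by (rule convex_convex_hull)

lemma interior_tetra_nonempty: "interior (tetra x) \<noteq> {}"
  using affine_independent_x unfolding tetra_V
  by (subst interior_convex_hull_eq_empty) (simp_all add: card_image[OF inj_x] card_V)

lemma grad_nonzero: "i \<in> V \<Longrightarrow> grad i \<noteq> 0"
proof
  assume i: "i \<in> V" "grad i = 0"
  obtain j where "j \<in> V" "j \<noteq> i"
    using other_vertex by blast
  then show False
    using grad_tangent[of i j i] i by simp
qed

lemma normal_eq:
  assumes i: "i \<in> V"
  shows "normal x i = - (inverse (norm (grad i)) *\<^sub>R grad i)"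
  unfolding normal_def
proof (rule the_equality, goal_cases)
  case 1
  have "grad i \<bullet> (z - y) \<ge> 0" if "y \<in> face x i" "z \<in> tetra x" for y z
  proof -
    have "bary x i z = grad i \<bullet> (z - y)"
      using that i bary_add[of i y "z - y"] by (simp add: face_eq)
    moreover have "0 \<le> bary x i z"
      using that i by (simp add: tetra_eq)
    ultimately show ?thesis by simp
  qed
  then show ?case
    using grad_nonzero[OF i] by (auto simp: field_simps)
next
  case (2 n)
  then have n: "norm n = 1" and le: "\<And>y z. y \<in> face x i \<Longrightarrow> z \<in> tetra x \<Longrightarrow> n \<bullet> (z - y) \<le> 0"
    by auto
  obtain m where m: "m \<in> V" "m \<noteq> i"
    using other_vertex by blast
  \<comment> \<open>A vector that is orthogonal to the edges of the face is a multiple of the gradient.\<close>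
  define a where "a = n \<bullet> x m"
  define d where "d = n \<bullet> x i - a"
  have xa: "n \<bullet> x j = a" if "j \<in> V - {i}" for j
  proof -
    have "x j \<in> face x i" "x m \<in> face x i"
      using that m i by (auto intro: vertex_in_face)
    then have "n \<bullet> (x j - x m) \<le> 0" "n \<bullet> (x m - x j) \<le> 0"
      using face_subset_tetra[OF i] by (auto intro: le)
    then show ?thesis
      by (simp add: a_def inner_diff_right)
  qed
  have "n \<bullet> w = (d *\<^sub>R grad i) \<bullet> w" for w
  proof -
    have "n \<bullet> w = (\<Sum>j\<in>V. (grad j \<bullet> w) * (n \<bullet> x j))"
      by (subst vector_eq_sum_grad[of w]) (simp add: inner_sum_right)
    also have "\<dots> = (\<Sum>j\<in>V. (grad j \<bullet> w) * a + (if j = i then (grad i \<bullet> w) * d else 0))"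
      using xa by (intro sum.cong) (auto simp: d_def algebra_simps)
    also have "\<dots> = (grad i \<bullet> w) * d"
      using i by (simp add: sum.distrib sum_grad_inner flip: sum_distrib_right)
    finally show ?thesis by simp
  qed
  then have nd: "n = d *\<^sub>R grad i"
    using vector_eq_rdot by blast
  have "x i \<in> tetra x"
    using i by (auto simp: tetra_V intro: hull_inc)
  then have "d \<le> 0"
    using le[OF vertex_in_face[of i m]] i m by (simp add: d_def a_def inner_diff_right)
  then have "d = - inverse (norm (grad i))"
    using n grad_nonzero[OF i] unfolding nd by (simp add: field_simps)
  then show ?case
    using nd by simp
qed

section \<open>The coefficient spaces\<close>

lemma point_eqI:
  assumes "\<And>a. a \<in> V \<Longrightarrow> bary x a y = bary x a z"
  shows "y = z"
proof -
  have "(\<Sum>a\<in>V. bary x a y *\<^sub>R x a) = (\<Sum>a\<in>V. bary x a z *\<^sub>R x a)"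
    using assms by (intro sum.cong) simp_all
  then show ?thesis
    by (simp only: sum_bary_scaleR)
qed

lemma opposite_edge:
  assumes "i \<in> V" "j \<in> V" "i \<noteq> j" "{l, m} = V - {i, j}"
  shows "V = {i, j, l, m}" "l \<in> V" "m \<in> V" "l \<noteq> m" "l \<noteq> i" "l \<noteq> j" "m \<noteq> i" "m \<noteq> j"
proof -
  have "l \<in> V - {i, j}" "m \<in> V - {i, j}"
    unfolding assms(4)[symmetric] by simp_all
  then show "l \<in> V" "m \<in> V" "l \<noteq> i" "l \<noteq> j" "m \<noteq> i" "m \<noteq> j"
    by simp_all
  have "V = {i, j} \<union> (V - {i, j})"
    using assms(1,2) by auto
  then show "V = {i, j, l, m}"
    unfolding assms(4)[symmetric] by (simp add: insert_commute)
  have "card {l, m} = 2"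
    unfolding assms(4) using assms(1-3) by (simp add: card_Diff_subset card_V)
  then show "l \<noteq> m" by auto
qed

lemma sum_opposite_edge:
  fixes f :: "nat \<Rightarrow> 'b::comm_monoid_add"
  assumes "i \<in> V" "j \<in> V" "i \<noteq> j" "{l, m} = V - {i, j}"
  shows "(\<Sum>a\<in>V. f a) = f i + (f j + (f l + f m))"
  using assms(3) opposite_edge(4-8)[OF assms] by (subst opposite_edge(1)[OF assms]) auto

lemma opposite_edge_exists:
  assumes "i \<in> V" "j \<in> V" "i \<noteq> j"
  obtains l m where "{l, m} = V - {i, j}"
proof -
  have "card (V - {i, j}) = 2"
    using assms by (simp add: card_Diff_subset card_V)
  then obtain l m where "V - {i, j} = {l, m}"
    unfolding card_2_iff by (elim exE conjE) (rule that)
  then show ?thesis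
    by (intro that) (rule sym)
qed

text \<open>
  The projection along the edge from \<open>x i\<close> to \<open>x j\<close> onto the plane of the face opposite to \<open>x i\<close>. It moves
  the barycentric weight at \<open>x i\<close> to \<open>x j\<close> and keeps the two other weights.
\<close>

definition proj :: "nat \<Rightarrow> nat \<Rightarrow> real^3 \<Rightarrow> real^3"
  where "proj i j y = y + bary x i y *\<^sub>R tangent x i j"

lemma bary_proj:
  assumes "i \<in> V" "j \<in> V" "i \<noteq> j" "a \<in> V"
  shows "bary x a (proj i j y) =
    (if a = i then 0 else if a = j then bary x i y + bary x j y else bary x a y)"
  using assms by (simp add: proj_def bary_add grad_tangent)

lemma proj_proj: "i \<in> V \<Longrightarrow> j \<in> V \<Longrightarrow> i \<noteq> j \<Longrightarrow> proj i j (proj j i y) = proj i j y"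
  by (rule point_eqI) (simp add: bary_proj)

lemma proj_in_face: "i \<in> V \<Longrightarrow> j \<in> V \<Longrightarrow> i \<noteq> j \<Longrightarrow> y \<in> tetra x \<Longrightarrow> proj i j y \<in> face x i"
  by (simp add: face_eq tetra_eq bary_proj)

lemma proj_id: "bary x i y = 0 \<Longrightarrow> proj i j y = y"
  by (simp add: proj_def)

lemma polys_bary: "i \<in> V \<Longrightarrow> bary x i \<in> polys (Suc m)"
  by (rule polys_affine[of _ "bary x i 0" "grad i"]) (rule bary_affine)

lemma polys_proj:
  fixes p :: "real^3 \<Rightarrow> real"
  assumes "i \<in> V" "p \<in> polys m"
  shows "(\<lambda>y. p (proj i j y)) \<in> polys m"
proof (rule polys_compose_affine[OF assms(2)])
  fix d n
  have "(\<lambda>y. y $ d) \<in> polys (Suc n)"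
    by (rule polys_affine[of _ 0 "axis d 1"]) (simp add: inner_axis')
  then have "(\<lambda>y. y $ d + tangent x i j $ d * bary x i y) \<in> polys (Suc n)"
    by (intro polys_add polys_cmult polys_bary assms)
  then show "(\<lambda>y. proj i j y $ d) \<in> polys (Suc n)"
    by (simp add: proj_def mult.commute)
qed

text \<open>
  Division by \<open>\<lambda>\<^sub>i\<close> and then by \<open>\<lambda>\<^sub>j\<close> yields \<open>p = p \<circ> \<pi>\<^sub>i\<^sub>j + \<lambda>\<^sub>i (q \<circ> \<pi>\<^sub>j\<^sub>i) + \<lambda>\<^sub>i \<lambda>\<^sub>j r\<close>. In the
  middle term, \<open>\<lambda>\<^sub>i\<close> is half of \<open>(\<lambda>\<^sub>i + \<lambda>\<^sub>j) - (\<lambda>\<^sub>j - \<lambda>\<^sub>i)\<close>, and \<open>\<lambda>\<^sub>i + \<lambda>\<^sub>j\<close> is invariant under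
  the projection, so that its part is absorbed in the first term.
\<close>

lemma polys_split:
  fixes p :: "real^3 \<Rightarrow> real"
  assumes "k \<ge> 1" "i \<in> V" "j \<in> V" "i \<noteq> j" "p \<in> polys k"
  obtains u h r where "u \<in> polys k" "h \<in> polys k" "r \<in> polys (k - 1)"
    "\<And>y. p y = u (proj i j y) + (bary x j y - bary x i y) * h (proj j i y)
       + bary x i y * bary x j y * r y"
proof -
  obtain q where q: "q \<in> polys (k - 1)" "\<forall>y. p y = p (proj i j y) + bary x i y * q y"
    using polys_shift_factor[OF assms(5) polys_bary[OF assms(2)], of "tangent x i j"]
    unfolding proj_def[symmetric] by (elim bexE conjE) (rule that)
  obtain r where r: "r \<in> polys (k - 1 - 1)" "\<forall>y. q y = q (proj j i y) + bary x j y * r y"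
    using polys_shift_factor[OF q(1) polys_bary[OF assms(3)], of "tangent x j i"]
    unfolding proj_def[symmetric] by (elim bexE conjE) (rule that)
  define u where "u z = p z + 1 / 2 * ((bary x i z + bary x j z) * q (proj j i z))" for z
  define h where "h z = - (1 / 2) * q z" for z
  show thesis
  proof (rule that)
    have "(\<lambda>z. (bary x i z + bary x j z) * q (proj j i z)) \<in> polys (Suc 0 + (k - 1))"
      using assms q(1) by (intro polys_mult polys_add polys_bary polys_proj)
    then show "u \<in> polys k"
      unfolding u_def using assms by (intro polys_add polys_cmult) auto
    show "h \<in> polys k"
      unfolding h_def by (intro polys_cmult polys_mono[OF q(1)]) simp
    show "r \<in> polys (k - 1)"
      by (rule polys_mono[OF r(1)]) simp
    fix y
    have "u (proj i j y) = p (proj i j y) + 1 / 2 * ((bary x i y + bary x j y) * q (proj j i y))"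
      using assms by (simp add: u_def bary_proj proj_proj)
    moreover have "p y = p (proj i j y) + bary x i y * (q (proj j i y) + bary x j y * r y)"
      using q(2)[rule_format, of y] by (simp add: r(2)[rule_format, of y, symmetric])
    ultimately show "p y = u (proj i j y) + (bary x j y - bary x i y) * h (proj j i y)
       + bary x i y * bary x j y * r y"
      unfolding h_def by (simp only:) (simp add: field_simps)
  qed
qed

text \<open>
  The generators are defined on the whole space, unlike those of \<open>hom_poly_space\<close>, so that polynomials
  can be composed with the projections, which do not map the complement of the tetrahedron to itself.
\<close>

definition homs :: "nat \<Rightarrow> nat \<Rightarrow> nat \<Rightarrow> (real^3 \<Rightarrow> real) set"
  where "homs l m n = span {\<lambda>y. bary x l y ^ m1 * bary x m y ^ m2 | m1 m2. m1 + m2 = n}"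

lemma hom_poly_space_eq: "hom_poly_space x k l m = restr (tetra x) ` homs l m k"
proof -
  have "restr (tetra x) ` {\<lambda>y. bary x l y ^ m1 * bary x m y ^ m2 | m1 m2. m1 + m2 = k} =
    {restr (tetra x) (\<lambda>y. bary x l y ^ m1 * bary x m y ^ m2) | m1 m2. m1 + m2 = k}"
    by blast
  then show ?thesis
    using linear_span_image[OF linear_restr, of "tetra x"
        "{\<lambda>y. bary x l y ^ m1 * bary x m y ^ m2 | m1 m2. m1 + m2 = k}"]
    unfolding hom_poly_space_def homs_def by simp
qed

lemma homs_add: "p \<in> homs l m n \<Longrightarrow> q \<in> homs l m n \<Longrightarrow> (\<lambda>y. p y + q y) \<in> homs l m n"
  using span_add[of p _ q] by (simp add: homs_def plus_fun_def)

lemma homs_cmult: "p \<in> homs l m n \<Longrightarrow> (\<lambda>y. c * p y) \<in> homs l m n"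
  using span_scale[of p _ c] by (simp add: homs_def scaleR_fun_def)

lemma homs_zero: "(\<lambda>y. 0) \<in> homs l m n"
  using span_zero by (simp add: homs_def zero_fun_def[symmetric])

lemma homs_monomial: "(\<lambda>y. bary x l y ^ m1 * bary x m y ^ m2) \<in> homs l m (m1 + m2)"
  unfolding homs_def by (rule span_base) blast

lemma homs_induct [consumes 1, case_names zero step]:
  assumes "q \<in> homs l m n" "Q (\<lambda>y. 0)"
    and "\<And>c m1 m2 q. m1 + m2 = n \<Longrightarrow> Q q \<Longrightarrow>
      Q (\<lambda>y. c * (bary x l y ^ m1 * bary x m y ^ m2) + q y)"
  shows "Q q"
  using assms(1) unfolding homs_def
proof (induction rule: span_induct_alt)
  case base
  show ?case using assms(2) by (simp add: zero_fun_def)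
next
  case (step c b q)
  then show ?case using assms(3) by (auto simp: plus_fun_def scaleR_fun_def)
qed

lemma homs_lin_mult:
  assumes "q \<in> homs l m n"
  shows "(\<lambda>y. (a * bary x l y + b * bary x m y) * q y) \<in> homs l m (Suc n)"
  using assms
proof (induction rule: homs_induct)
  case zero
  show ?case using homs_zero by simp
next
  case (step c m1 m2 q)
  have "(\<lambda>y. (c * a) * (bary x l y ^ Suc m1 * bary x m y ^ m2)) \<in> homs l m (Suc n)"
    "(\<lambda>y. (c * b) * (bary x l y ^ m1 * bary x m y ^ Suc m2)) \<in> homs l m (Suc n)"
    using homs_monomial[of l "Suc m1" m m2] homs_monomial[of l m1 m "Suc m2"] step(1)
    by (auto intro!: homs_cmult)
  from homs_add[OF homs_add[OF this] step(2)] show ?case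
    by (simp add: algebra_simps)
qed

lemma homs_polys: "q \<in> homs l m n \<Longrightarrow> l \<in> V \<Longrightarrow> m \<in> V \<Longrightarrow> q \<in> polys n"
proof (induction rule: homs_induct)
  case zero
  show ?case by (rule polys_const)
next
  case (step c m1 m2 q)
  then show ?case
    using polys_mult[OF polys_power[OF polys_bary] polys_power[OF polys_bary], of l m m1 m2]
    by (intro polys_add polys_cmult) auto
qed

lemma homs_proj:
  assumes "q \<in> homs l m n" "i \<in> V" "j \<in> V" "i \<noteq> j" "{l, m} = V - {i, j}"
  shows "q (proj i j y) = q y"
  using assms(1)
proof (induction rule: homs_induct)
  case (step c m1 m2 q)
  then show ?case
    using assms(2-4) opposite_edge(2-8)[OF assms(2-5)] by (simp add: bary_proj)
qed simp

text \<open>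
  On the plane of the face, \<open>\<lambda>\<^sub>l\<close> and \<open>\<lambda>\<^sub>m\<close> are affine coordinates. In these coordinates a polynomial is
  its homogeneous part of top degree plus lower terms. This is why the homogeneous polynomials in the
  definition of the coefficient space suffice: multiplied by \<open>\<lambda>\<^sub>i - \<lambda>\<^sub>j\<close>, the lower terms have degree
  at most \<open>n\<close> anyway.
\<close>

lemma polys_proj_leading:
  fixes p :: "real^3 \<Rightarrow> real"
  assumes ij: "i \<in> V" "j \<in> V" "i \<noteq> j" "{l, m} = V - {i, j}" and p: "p \<in> polys n"
  shows "\<exists>q\<in>homs l m n. \<exists>r\<in>polys (n - 1).
    (n = 0 \<longrightarrow> r = (\<lambda>y. 0)) \<and> (\<forall>y. p (proj i j y) = q y + r y)"
  using p
proof (induction rule: polys_induct)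
  case (const n c)
  show ?case
  proof (cases n)
    case 0
    then show ?thesis
      using homs_cmult[OF homs_monomial[of l 0 m 0], of c] polys_const[of 0]
      by (intro bexI[of _ "\<lambda>y. c"] bexI[of _ "\<lambda>y. 0"]) auto
  next
    case Suc
    then show ?thesis
      using homs_zero polys_const[of c]
      by (intro bexI[of _ "\<lambda>y. 0"] bexI[of _ "\<lambda>y. c"]) auto
  qed
next
  case (add n p p')
  from add(3) obtain q r where 1: "q \<in> homs l m n" "r \<in> polys (n - 1)" "n = 0 \<longrightarrow> r = (\<lambda>y. 0)"
    "\<forall>y. p (proj i j y) = q y + r y" by (elim bexE conjE) (rule that)
  from add(4) obtain q' r' where 2: "q' \<in> homs l m n" "r' \<in> polys (n - 1)" "n = 0 \<longrightarrow> r' = (\<lambda>y. 0)"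
    "\<forall>y. p' (proj i j y) = q' y + r' y" by (elim bexE conjE) (rule that)
  have "\<forall>y. p (proj i j y) + p' (proj i j y) = (q y + q' y) + (r y + r' y)"
    using 1(4) 2(4) by simp
  moreover have "n = 0 \<longrightarrow> (\<lambda>y. r y + r' y) = (\<lambda>y. 0)"
    using 1(3) 2(3) by simp
  ultimately show ?case
    using homs_add[OF 1(1) 2(1)] polys_add[OF 1(2) 2(2)]
    by (intro bexI[of _ "\<lambda>y. q y + q' y"] bexI[of _ "\<lambda>y. r y + r' y"] conjI)
next
  case (mult n p d)
  from mult(2) obtain q r where 1: "q \<in> homs l m n" "r \<in> polys (n - 1)" "n = 0 \<longrightarrow> r = (\<lambda>y. 0)"
    "\<forall>y. p (proj i j y) = q y + r y" by (elim bexE conjE) (rule that)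
  note V = opposite_edge[OF ij]
  define c where "c = x j $ d"
  define a where "a = x l $ d - c"
  define b where "b = x m $ d - c"
  have coord: "proj i j y $ d = c + (a * bary x l y + b * bary x m y)" for y
  proof -
    have ij_eq: "bary x i y + bary x j y = 1 - bary x l y - bary x m y"
      using sum_bary[of y] unfolding sum_opposite_edge[OF ij] by simp
    have "proj i j y = (\<Sum>a\<in>V. bary x a (proj i j y) *\<^sub>R x a)"
      by (simp add: sum_bary_scaleR)
    then have "proj i j y = (bary x i y + bary x j y) *\<^sub>R x j + bary x l y *\<^sub>R x l + bary x m y *\<^sub>R x m"
      unfolding sum_opposite_edge[OF ij] using V(2-8) ij(1-3) by (simp add: bary_proj add.assoc)
    then have "proj i j y $ d =
        (bary x i y + bary x j y) * x j $ d + bary x l y * x l $ d + bary x m y * x m $ d"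
      by simp
    then show ?thesis
      unfolding ij_eq by (simp add: a_def b_def c_def algebra_simps)
  qed
  have pol: "(\<lambda>y. c + (a * bary x l y + b * bary x m y)) \<in> polys (Suc 0)"
    using V(2,3) by (intro polys_add polys_const polys_cmult polys_bary)
  have "(\<lambda>y. (c + (a * bary x l y + b * bary x m y)) * r y) \<in> polys n"
    using polys_mult[OF pol 1(2)] 1(3) by (cases n) (auto intro: polys_const)
  then have "(\<lambda>y. c * q y + (c + (a * bary x l y + b * bary x m y)) * r y) \<in> polys (Suc n - 1)"
    using V(2,3) homs_polys[OF 1(1)] by (auto intro!: polys_add polys_cmult)
  moreover have "\<forall>y. proj i j y $ d * p (proj i j y) = (a * bary x l y + b * bary x m y) * q y
      + (c * q y + (c + (a * bary x l y + b * bary x m y)) * r y)"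
    unfolding coord 1(4)[rule_format] by (simp add: algebra_simps)
  ultimately show ?case
    using homs_lin_mult[OF 1(1), of a b]
    by (intro bexI[of _ "\<lambda>y. (a * bary x l y + b * bary x m y) * q y"]
      bexI[of _ "\<lambda>y. c * q y + (c + (a * bary x l y + b * bary x m y)) * r y"]) simp_all
qed

definition coeff_fun ::
    "nat \<Rightarrow> nat \<Rightarrow> (real^3 \<Rightarrow> real) \<Rightarrow> (real^3 \<Rightarrow> real) \<Rightarrow> (real^3 \<Rightarrow> real) \<Rightarrow> real^3 \<Rightarrow> real"
  where "coeff_fun i j u h r y = u (proj i j y) + (bary x j y - bary x i y) * h (proj j i y)
    + bary x i y * bary x j y * r y"

lemmas coeff_space_V = coeff_space_def[where x = x, folded V_def]

text \<open>
  The normal form. It replaces the two overlapping summands of low degree by functions on the two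
  faces, on which the traces can be read off.
\<close>

lemma coeff_space_eq:
  assumes k: "k \<ge> 1" and ij: "i \<in> V" "j \<in> V" "i \<noteq> j"
  shows "coeff_space x k i j =
    {restr (tetra x) (coeff_fun i j u h r) | u h r. u \<in> polys k \<and> h \<in> polys k \<and> r \<in> polys (k - 1)}"
    (is "_ = ?R")
proof (intro set_eqI iffI)
  fix f assume "f \<in> coeff_space x k i j"
  then obtain p q r l m where f: "f = (\<lambda>y. p y + (bary x i y - bary x j y) * q y + bary x i y * bary x j y * r y)"
    and lm: "{l, m} = V - {i, j}" and p: "p \<in> poly_space k (tetra x)"
    and q: "q \<in> hom_poly_space x k l m" and r: "r \<in> poly_space (k - 1) (tetra x)"
    unfolding coeff_space_V mem_Collect_eq by (elim exE conjE) (rule that)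
  obtain p' where p': "p' \<in> polys k" "p = restr (tetra x) p'"
    using p by (rule poly_spaceE) (rule that)
  obtain r' where r': "r' \<in> polys (k - 1)" "r = restr (tetra x) r'"
    using r by (rule poly_spaceE) (rule that)
  obtain q' where q': "q = restr (tetra x) q'" "q' \<in> homs l m k"
    using q by (subst (asm) hom_poly_space_eq) blast
  obtain u h s where uhs: "u \<in> polys k" "h \<in> polys k" "s \<in> polys (k - 1)"
    "\<And>y. p' y = u (proj i j y) + (bary x j y - bary x i y) * h (proj j i y) + bary x i y * bary x j y * s y"
    by (rule polys_split[OF k ij p'(1)]) (rule that)
  have lm': "{l, m} = V - {j, i}"
    using lm by blast
  have qi: "q' (proj j i y) = q' y" for y
    using homs_proj[OF q'(2) ij(2,1) ij(3)[symmetric] lm'] .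
  have "f = restr (tetra x) (coeff_fun i j u (\<lambda>y. h y - q' y) (\<lambda>y. s y + r' y))"
    by (auto simp: f p'(2) r'(2) q'(1) restr_def coeff_fun_def uhs(4) qi fun_eq_iff algebra_simps)
  moreover have "(\<lambda>y. h y - q' y) \<in> polys k" "(\<lambda>y. s y + r' y) \<in> polys (k - 1)"
    using uhs(2,3) r'(1) homs_polys[OF q'(2)] opposite_edge(2,3)[OF ij lm] by (auto intro!: polys_diff polys_add)
  ultimately show "f \<in> ?R"
    using uhs(1) by blast
next
  fix f assume "f \<in> ?R"
  then obtain u h r where f: "f = restr (tetra x) (coeff_fun i j u h r)"
    and uhr: "u \<in> polys k" "h \<in> polys k" "r \<in> polys (k - 1)"
    by blast
  obtain l m where lm: "{l, m} = V - {i, j}"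
    using opposite_edge_exists[OF ij] .
  then have lm': "{l, m} = V - {j, i}"
    by blast
  obtain q s where qs: "q \<in> homs l m k" "s \<in> polys (k - 1)" "\<forall>y. h (proj j i y) = q y + s y"
    using polys_proj_leading[OF ij(2,1) ij(3)[symmetric] lm' uhr(2)] by (elim bexE conjE) (rule that)
  have "(\<lambda>y. (bary x j y - bary x i y) * s y) \<in> polys (Suc 0 + (k - 1))"
    using ij qs(2) by (intro polys_mult polys_diff polys_bary)
  then have p: "(\<lambda>y. u (proj i j y) + (bary x j y - bary x i y) * s y) \<in> polys k" (is "?p \<in> _")
    using k ij uhr(1) by (auto intro!: polys_add polys_proj)
  have q: "(\<lambda>y. (- 1) * q y) \<in> homs l m k"
    by (rule homs_cmult[OF qs(1)])
  have "f = (\<lambda>y. restr (tetra x) ?p y + (bary x i y - bary x j y) * restr (tetra x) (\<lambda>y. (- 1) * q y) y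
      + bary x i y * bary x j y * restr (tetra x) r y)"
    by (auto simp: f restr_def coeff_fun_def qs(3) fun_eq_iff algebra_simps)
  moreover have "restr (tetra x) ?p \<in> poly_space k (tetra x)"
    "restr (tetra x) r \<in> poly_space (k - 1) (tetra x)"
    "restr (tetra x) (\<lambda>y. (- 1) * q y) \<in> hom_poly_space x k l m"
    unfolding hom_poly_space_eq by (intro poly_spaceI imageI p q uhr(3))+
  ultimately show "f \<in> coeff_space x k i j"
    using lm unfolding coeff_space_V mem_Collect_eq
    by (intro exI[of _ "restr (tetra x) ?p"] exI[of _ "restr (tetra x) (\<lambda>y. (- 1) * q y)"]
        exI[of _ "restr (tetra x) r"] exI[of _ l] exI[of _ m] conjI)
qed

section \<open>The structure of the shape function space\<close>

definition pairs :: "(nat \<times> nat) set"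
  where "pairs = {(i, j). i \<in> V \<and> j \<in> V \<and> i < j}"

lemma pairs_eq: "{(i, j). 1 \<le> i \<and> i < j \<and> j \<le> 4} = pairs"
  by (auto simp: pairs_def V_def)

lemma finite_pairs: "finite pairs"
  by (rule finite_subset[of _ "V \<times> V"]) (auto simp: pairs_def)

lemma all_pairs_iff: "(\<forall>i j. 1 \<le> i \<and> i < j \<and> j \<le> 4 \<longrightarrow> Q i j) \<longleftrightarrow> (\<forall>i j. (i, j) \<in> pairs \<longrightarrow> Q i j)"
  by (auto simp: pairs_def V_def)

lemma pairsD: "(i, j) \<in> pairs \<Longrightarrow> i \<in> V \<and> j \<in> V \<and> i \<noteq> j \<and> i < j"
  by (simp add: pairs_def)

definition matrix_field :: "(nat \<Rightarrow> nat \<Rightarrow> real^3 \<Rightarrow> real) \<Rightarrow> real^3 \<Rightarrow> real^3^3"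
  where "matrix_field P y = (\<Sum>(i, j)\<in>pairs. P i j y *\<^sub>R self_outer (tangent x i j))"

lemma matrix_field_cong:
  assumes "\<And>i j. (i, j) \<in> pairs \<Longrightarrow> P i j y = Q i j y"
  shows "matrix_field P y = matrix_field Q y"
  unfolding matrix_field_def by (rule sum.cong) (auto simp: assms)

lemma matrix_field_add:
  "matrix_field (\<lambda>i j y. P i j y + Q i j y) y = matrix_field P y + matrix_field Q y"
  by (simp add: matrix_field_def scaleR_add_left sum.distrib case_prod_beta)

lemma matrix_field_scaleR:
  "matrix_field (\<lambda>i j y. c * P i j y) y = c *\<^sub>R matrix_field P y"
  by (simp add: matrix_field_def scaleR_sum_right case_prod_beta)

lemma continuous_on_matrix_field:
  "(\<And>i j. (i, j) \<in> pairs \<Longrightarrow> continuous_on S (P i j)) \<Longrightarrow> continuous_on S (matrix_field P)"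
  unfolding matrix_field_def[abs_def] case_prod_beta
  by (intro continuous_intros) auto

lemma Sigma_nc_eq_matrix_field:
  "Sigma_nc x k = {matrix_field p | p. \<forall>i j. (i, j) \<in> pairs \<longrightarrow> p i j \<in> coeff_space x k i j}"
  unfolding Sigma_nc_def pairs_eq all_pairs_iff matrix_field_def[abs_def] ..

lemma H_bubble_eq_matrix_field:
  "H_bubble x k = {matrix_field (\<lambda>i j y. bary x i y * bary x j y * r i j y) | r.
     \<forall>i j. (i, j) \<in> pairs \<longrightarrow> r i j \<in> poly_space (k - 1) (tetra x)}"
  unfolding H_bubble_def pairs_eq all_pairs_iff matrix_field_def[abs_def] ..

lemma continuous_on_coeff_fun:
  assumes "i \<in> V" "j \<in> V" "u \<in> polys k" "h \<in> polys k" "r \<in> polys m"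
  shows "continuous_on S (coeff_fun i j u h r)"
proof -
  have "continuous_on S (\<lambda>y. u (proj i j y))" "continuous_on S (\<lambda>y. h (proj j i y))"
    "continuous_on S r"
    using continuous_on_poly_space[OF polys_proj[OF assms(1,3)], of j]
      continuous_on_poly_space[OF polys_proj[OF assms(2,4)], of i]
      continuous_on_poly_space[OF assms(5)]
    by (auto intro: continuous_on_subset)
  then show ?thesis
    unfolding coeff_fun_def[abs_def] using assms(1,2)
    by (intro continuous_intros continuous_on_bary)
qed

lemma continuous_on_coeff_space:
  assumes "k \<ge> 1" "(i, j) \<in> pairs" "p \<in> coeff_space x k i j"
  shows "continuous_on (tetra x) p"
proof -
  have ij: "i \<in> V" "j \<in> V" "i \<noteq> j"
    using pairsD[OF assms(2)] by auto
  obtain u h r where uhr: "p = restr (tetra x) (coeff_fun i j u h r)" "u \<in> polys k" "h \<in> polys k" "r \<in> polys (k - 1)"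
    using assms(3) unfolding coeff_space_eq[OF assms(1) ij] by blast
  show ?thesis
    by (rule continuous_on_eq[OF continuous_on_coeff_fun[OF ij(1,2) uhr(2-4)]])
      (simp add: uhr(1) restr_apply)
qed

lemma continuous_on_Sigma_nc: "k \<ge> 1 \<Longrightarrow> \<tau> \<in> Sigma_nc x k \<Longrightarrow> continuous_on (tetra x) \<tau>"
  unfolding Sigma_nc_eq_matrix_field by (auto intro!: continuous_on_matrix_field continuous_on_coeff_space[of k])

lemma continuous_on_H_bubble: "c \<in> H_bubble x k \<Longrightarrow> continuous_on (tetra x) c"
  unfolding H_bubble_eq_matrix_field
  by (auto intro!: continuous_on_matrix_field continuous_on_mult continuous_on_bary
      dest: pairsD continuous_on_poly_space)

lemma H_bubble_outside: "c \<in> H_bubble x k \<Longrightarrow> y \<notin> tetra x \<Longrightarrow> c y = 0"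
proof -
  assume "c \<in> H_bubble x k" and y: "y \<notin> tetra x"
  then obtain r where c: "c = matrix_field (\<lambda>i j y. bary x i y * bary x j y * r i j y)"
    and r: "\<And>i j. (i, j) \<in> pairs \<Longrightarrow> r i j \<in> poly_space (k - 1) (tetra x)"
    unfolding H_bubble_eq_matrix_field by blast
  have "r i j y = 0" if "(i, j) \<in> pairs" for i j
    using r[OF that] by (rule poly_spaceE) (simp add: restr_apply y)
  then have "c y = matrix_field (\<lambda>i j y. 0) y"
    unfolding c by (intro matrix_field_cong) simp
  then show "c y = 0"
    by (simp add: matrix_field_def case_prod_beta)
qed

lemma H_bubble_finitely_spanned: "\<exists>S. finite S \<and> H_bubble x k \<subseteq> span S"
proof -
  obtain S0 :: "(real^3 \<Rightarrow> real) set" where S0: "finite S0" "poly_space (k - 1) (tetra x) \<subseteq> span S0"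
    using poly_space_finitely_spanned by blast
  define G where "G z r = (\<lambda>y. (bary x (fst z) y * bary x (snd z) y * r y) *\<^sub>R self_outer (tangent x (fst z) (snd z)))"
    for z and r :: "real^3 \<Rightarrow> real"
  let ?S = "\<Union>z\<in>pairs. G z ` S0"
  have lin: "linear (G z)" for z
    by (rule linearI) (simp_all add: G_def fun_eq_iff plus_fun_def scaleR_fun_def algebra_simps)
  have G: "G z r \<in> span ?S" if "z \<in> pairs" "r \<in> span S0" for z r
  proof -
    have "G z r \<in> span (G z ` S0)"
      using that(2) unfolding linear_span_image[OF lin] by (rule imageI)
    also have "\<dots> \<subseteq> span ?S"
      using that(1) by (intro span_mono) blast
    finally show ?thesis .
  qed
  have "c \<in> span ?S" if c: "c \<in> H_bubble x k" for c
  proof -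
    obtain r where c: "c = matrix_field (\<lambda>i j y. bary x i y * bary x j y * r i j y)"
      and r: "\<And>i j. (i, j) \<in> pairs \<Longrightarrow> r i j \<in> poly_space (k - 1) (tetra x)"
      using c unfolding H_bubble_eq_matrix_field by blast
    have app: "(\<Sum>z\<in>T. F z) y = (\<Sum>z\<in>T. F z y)" for F :: "nat \<times> nat \<Rightarrow> real^3 \<Rightarrow> real^3^3" and T y
      by (induction T rule: infinite_finite_induct) auto
    have "c = (\<Sum>z\<in>pairs. G z (r (fst z) (snd z)))"
      by (rule ext) (simp add: c app matrix_field_def G_def case_prod_beta)
    also have "\<dots> \<in> span ?S"
      using r S0(2) by (intro span_sum G) auto
    finally show ?thesis .
  qed
  moreover have "finite ?S"
    using S0(1) finite_pairs by simp
  ultimately show ?thesis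
    by blast
qed

text \<open>
  A vector field on the face opposite to \<open>x i\<close> has one component for each edge \<open>(i, j)\<close> at \<open>x i\<close>, namely its
  product with \<open>grad j\<close>. The coefficient at an edge is composed of the two components that belong to this
  edge, one from each of the faces opposite to its ends; they take the places of \<open>u\<close> and \<open>h\<close> in the normal
  form.
\<close>

definition assemble :: "(nat \<Rightarrow> real^3 \<Rightarrow> real^3) \<Rightarrow> real^3 \<Rightarrow> real^3^3"
  where "assemble v = matrix_field (\<lambda>i j. restr (tetra x)
    (coeff_fun i j (\<lambda>y. grad j \<bullet> v i y) (\<lambda>y. grad i \<bullet> v j y) (\<lambda>y. 0)))"

lemma assemble_add: "assemble (\<lambda>i. v i + w i) = assemble v + assemble w"
proof
  fix y
  have "assemble (\<lambda>i. v i + w i) y = matrix_field (\<lambda>i j y.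
      restr (tetra x) (coeff_fun i j (\<lambda>y. grad j \<bullet> v i y) (\<lambda>y. grad i \<bullet> v j y) (\<lambda>y. 0)) y +
      restr (tetra x) (coeff_fun i j (\<lambda>y. grad j \<bullet> w i y) (\<lambda>y. grad i \<bullet> w j y) (\<lambda>y. 0)) y) y"
    unfolding assemble_def
    by (rule matrix_field_cong) (simp add: restr_apply coeff_fun_def inner_add_right algebra_simps)
  then show "assemble (\<lambda>i. v i + w i) y = (assemble v + assemble w) y"
    unfolding matrix_field_add by (simp add: assemble_def)
qed

lemma assemble_scaleR: "assemble (\<lambda>i. c *\<^sub>R v i) = c *\<^sub>R assemble v"
proof
  fix y
  have "assemble (\<lambda>i. c *\<^sub>R v i) y = matrix_field (\<lambda>i j y.
      c * restr (tetra x) (coeff_fun i j (\<lambda>y. grad j \<bullet> v i y) (\<lambda>y. grad i \<bullet> v j y) (\<lambda>y. 0)) y) y"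
    unfolding assemble_def
    by (rule matrix_field_cong) (simp add: restr_apply coeff_fun_def scaleR_fun_def algebra_simps)
  then show "assemble (\<lambda>i. c *\<^sub>R v i) y = (c *\<^sub>R assemble v) y"
    unfolding matrix_field_scaleR by (simp add: assemble_def scaleR_fun_def)
qed

lemma assemble_sum:
  "finite T \<Longrightarrow> assemble (\<lambda>i. \<Sum>z\<in>T. c z *\<^sub>R f z i) = (\<Sum>z\<in>T. c z *\<^sub>R assemble (f z))"
proof (induction T rule: finite_induct)
  case empty
  show ?case using assemble_scaleR[of 0 "\<lambda>i. 0"] by (simp only: scaleR_zero_left sum.empty)
next
  case (insert z T)
  show ?case
    using assemble_add[of "\<lambda>i. c z *\<^sub>R f z i" "\<lambda>i. \<Sum>z\<in>T. c z *\<^sub>R f z i"]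
    by (simp only: sum.insert[OF insert.hyps] assemble_scaleR insert.IH)
qed

lemma assemble_cong: "(\<And>i. i \<in> V \<Longrightarrow> v i = w i) \<Longrightarrow> assemble v = assemble w"
  unfolding assemble_def
  by (rule ext, rule matrix_field_cong) (auto simp: pairs_def)

lemma assemble_zero: "(\<And>i. i \<in> V \<Longrightarrow> v i = 0) \<Longrightarrow> assemble v = 0"
  using assemble_cong[of v "\<lambda>i. 0"] assemble_scaleR[of 0 "\<lambda>i. 0"] by (simp only: scaleR_zero_left)

lemma assemble_plus_bubble_eq:
  "assemble v y + matrix_field (\<lambda>i j y. bary x i y * bary x j y * restr (tetra x) (r i j) y) y =
   matrix_field (\<lambda>i j. restr (tetra x)
      (coeff_fun i j (\<lambda>y. grad j \<bullet> v i y) (\<lambda>y. grad i \<bullet> v j y) (r i j))) y"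
  unfolding assemble_def matrix_field_add[symmetric]
  by (rule matrix_field_cong) (simp add: restr_apply coeff_fun_def)

lemma coeff_fun_cong:
  assumes "u (proj i j y) = u' (proj i j y)" "h (proj j i y) = h' (proj j i y)" "r y = r' y"
  shows "coeff_fun i j u h r y = coeff_fun i j u' h' r' y"
  using assms by (simp add: coeff_fun_def)

text \<open>
  The data on the faces and in the bubble are restrictions; the coefficients of the assembled field are
  restrictions of the normal form for any polynomials that extend the data, because the projections map the
  tetrahedron into the faces.
\<close>

lemma assemble_plus_bubble_polys:
  assumes v: "\<And>i. i \<in> V \<Longrightarrow> v i \<in> poly_space k (face x i)" and c: "c \<in> H_bubble x k"
  obtains w r where "\<And>i. i \<in> V \<Longrightarrow> w i \<in> polys k" "\<And>i. i \<in> V \<Longrightarrow> v i = restr (face x i) (w i)"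
    "\<And>i j. (i, j) \<in> pairs \<Longrightarrow> r i j \<in> polys (k - 1)"
    "assemble v + c = matrix_field (\<lambda>i j. restr (tetra x)
      (coeff_fun i j (\<lambda>y. grad j \<bullet> w i y) (\<lambda>y. grad i \<bullet> w j y) (r i j)))"
proof -
  have "\<exists>w. i \<in> V \<longrightarrow> w \<in> polys k \<and> v i = restr (face x i) w" for i
    using v[of i] by (cases "i \<in> V") (auto elim: poly_spaceE)
  then obtain w where w: "\<And>i. i \<in> V \<Longrightarrow> w i \<in> polys k" "\<And>i. i \<in> V \<Longrightarrow> v i = restr (face x i) (w i)"
    by metis
  obtain r' where c_eq: "c = matrix_field (\<lambda>i j y. bary x i y * bary x j y * r' i j y)"
    and r': "\<And>i j. (i, j) \<in> pairs \<Longrightarrow> r' i j \<in> poly_space (k - 1) (tetra x)"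
    using c unfolding H_bubble_eq_matrix_field by blast
  have "\<exists>r. (i, j) \<in> pairs \<longrightarrow> r \<in> polys (k - 1) \<and> r' i j = restr (tetra x) r" for i j
    using r'[of i j] by (cases "(i, j) \<in> pairs") (auto elim: poly_spaceE)
  then obtain r where r: "\<And>i j. (i, j) \<in> pairs \<Longrightarrow> r i j \<in> polys (k - 1)"
    "\<And>i j. (i, j) \<in> pairs \<Longrightarrow> r' i j = restr (tetra x) (r i j)"
    by metis
  let ?p = "\<lambda>i j. restr (tetra x)
    (coeff_fun i j (\<lambda>y. grad j \<bullet> w i y) (\<lambda>y. grad i \<bullet> w j y) (r i j))"
  have "assemble v + c = matrix_field ?p"
  proof
    fix y
    have "c y = matrix_field (\<lambda>i j y. bary x i y * bary x j y * restr (tetra x) (r i j) y) y"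
      unfolding c_eq by (rule matrix_field_cong) (simp add: r(2))
    then have "(assemble v + c) y = matrix_field (\<lambda>i j. restr (tetra x)
        (coeff_fun i j (\<lambda>y. grad j \<bullet> v i y) (\<lambda>y. grad i \<bullet> v j y) (r i j))) y"
      using assemble_plus_bubble_eq[of v y r] by simp
    also have "\<dots> = matrix_field ?p y"
    proof (rule matrix_field_cong)
      fix i j assume "(i, j) \<in> pairs"
      then have ij: "i \<in> V" "j \<in> V" "i \<noteq> j" by (auto dest: pairsD)
      show "restr (tetra x) (coeff_fun i j (\<lambda>y. grad j \<bullet> v i y) (\<lambda>y. grad i \<bullet> v j y) (r i j)) y = ?p i j y"
        using ij proj_in_face[OF ij, of y] proj_in_face[OF ij(2,1) ij(3)[symmetric], of y]
        by (auto simp: restr_apply w(2) intro!: coeff_fun_cong)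
    qed
    finally show "(assemble v + c) y = matrix_field ?p y" .
  qed
  from w r(1) this show thesis
    by (rule that)
qed

lemma assemble_in_Sigma_nc:
  assumes k: "k \<ge> 1" and v: "\<And>i. i \<in> V \<Longrightarrow> v i \<in> poly_space k (face x i)" and c: "c \<in> H_bubble x k"
  shows "assemble v + c \<in> Sigma_nc x k"
proof -
  obtain w r where w: "\<And>i. i \<in> V \<Longrightarrow> w i \<in> polys k"
    and r: "\<And>i j. (i, j) \<in> pairs \<Longrightarrow> r i j \<in> polys (k - 1)"
    and eq: "assemble v + c = matrix_field (\<lambda>i j. restr (tetra x)
      (coeff_fun i j (\<lambda>y. grad j \<bullet> w i y) (\<lambda>y. grad i \<bullet> w j y) (r i j)))"
    by (rule assemble_plus_bubble_polys[OF v c], assumption) (rule that)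
  have "restr (tetra x) (coeff_fun i j (\<lambda>y. grad j \<bullet> w i y) (\<lambda>y. grad i \<bullet> w j y) (r i j))
      \<in> coeff_space x k i j" if "(i, j) \<in> pairs" for i j
  proof -
    have ij: "i \<in> V" "j \<in> V" "i \<noteq> j" using pairsD[OF that] by auto
    show ?thesis
      unfolding coeff_space_eq[OF k ij] mem_Collect_eq
      by (intro exI conjI) (rule refl polys_inner w ij r that)+
  qed
  then show ?thesis
    unfolding Sigma_nc_eq_matrix_field eq by blast
qed

text \<open>
  The tangents \<open>tangent x i j\<close> are dual to the gradients \<open>grad j\<close>, for fixed \<open>i\<close> and \<open>j \<noteq> i\<close>. Hence the
  functions \<open>u\<close> and \<open>h\<close> of all normal forms can be prescribed as components of vector fields on the faces.
\<close>

lemma Sigma_nc_decompose: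
  assumes k: "k \<ge> 1" and "\<tau> \<in> Sigma_nc x k"
  obtains v c where "\<And>i. i \<in> V \<Longrightarrow> v i \<in> poly_space k (face x i)" "c \<in> H_bubble x k"
    "\<tau> = assemble v + c"
proof -
  obtain p where \<tau>: "\<tau> = matrix_field p" and p: "\<And>i j. (i, j) \<in> pairs \<Longrightarrow> p i j \<in> coeff_space x k i j"
    using assms(2) unfolding Sigma_nc_eq_matrix_field by blast
  have "\<exists>F. (i, j) \<in> pairs \<longrightarrow> p i j = restr (tetra x) (coeff_fun i j (fst F) (fst (snd F)) (snd (snd F)))
      \<and> fst F \<in> polys k \<and> fst (snd F) \<in> polys k \<and> snd (snd F) \<in> polys (k - 1)" for i j
  proof (cases "(i, j) \<in> pairs")
    case True
    then have ij: "i \<in> V" "j \<in> V" "i \<noteq> j" by (auto dest: pairsD)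
    obtain u h r where "p i j = restr (tetra x) (coeff_fun i j u h r)" "u \<in> polys k" "h \<in> polys k" "r \<in> polys (k - 1)"
      using p[OF True] unfolding coeff_space_eq[OF k ij] by blast
    then show ?thesis
      by (intro exI[of _ "(u, h, r)"]) simp
  qed simp
  then obtain F where F: "\<And>i j. (i, j) \<in> pairs \<longrightarrow> p i j = restr (tetra x) (coeff_fun i j (fst (F i j)) (fst (snd (F i j))) (snd (snd (F i j))))
      \<and> fst (F i j) \<in> polys k \<and> fst (snd (F i j)) \<in> polys k \<and> snd (snd (F i j)) \<in> polys (k - 1)"
    by metis
  define u where "u i j = fst (F i j)" for i j
  define h where "h i j = fst (snd (F i j))" for i j
  define r where "r i j = snd (snd (F i j))" for i j
  have uhr: "p i j = restr (tetra x) (coeff_fun i j (u i j) (h i j) (r i j))"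
    "u i j \<in> polys k" "h i j \<in> polys k" "r i j \<in> polys (k - 1)" if "(i, j) \<in> pairs" for i j
    using F[of i j] that by (simp_all add: u_def h_def r_def)
  define U where "U i j = (if i < j then u i j else h j i)" for i j
  define v where "v i = restr (face x i) (\<lambda>y. \<Sum>j\<in>V - {i}. U i j y *\<^sub>R tangent x i j)" for i
  define c where "c = matrix_field (\<lambda>i j y. bary x i y * bary x j y * restr (tetra x) (r i j) y)"
  have U: "U i j \<in> polys k" if "i \<in> V" "j \<in> V - {i}" for i j
    using that uhr(2)[of i j] uhr(3)[of j i] by (auto simp: U_def pairs_def)
  show thesis
  proof (rule that)
    show "v i \<in> poly_space k (face x i)" if "i \<in> V" for i
      unfolding v_def using U that by (intro poly_spaceI polys_sum polys_times_const)
    show "c \<in> H_bubble x k"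
      unfolding H_bubble_eq_matrix_field c_def mem_Collect_eq
      by (rule exI[of _ "\<lambda>i j. restr (tetra x) (r i j)"]) (intro conjI refl allI impI poly_spaceI uhr(4))
    have grad_v: "grad j \<bullet> v i y = U i j y" if "i \<in> V" "j \<in> V" "i \<noteq> j" "y \<in> face x i" for i j y
    proof -
      have "grad j \<bullet> v i y = (\<Sum>m\<in>V - {i}. U i m y * (grad j \<bullet> tangent x i m))"
        using that by (simp add: v_def restr_apply inner_sum_right)
      also have "\<dots> = (\<Sum>m\<in>V - {i}. if m = j then U i j y else 0)"
        using that by (intro sum.cong refl) (auto simp: grad_tangent)
      finally have "grad j \<bullet> v i y = (\<Sum>m\<in>V - {i}. if m = j then U i j y else 0)" .
      then show ?thesis
        using that by simp
    qed
    show "\<tau> = assemble v + c"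
    proof
      fix y
      have "\<tau> y = matrix_field (\<lambda>i j. restr (tetra x)
        (coeff_fun i j (\<lambda>y. grad j \<bullet> v i y) (\<lambda>y. grad i \<bullet> v j y) (r i j))) y"
        unfolding \<tau>
      proof (rule matrix_field_cong)
        fix i j assume p: "(i, j) \<in> pairs"
        then have ij: "i \<in> V" "j \<in> V" "i \<noteq> j" "i < j" by (auto dest: pairsD)
        have "U i j = u i j" "U j i = h i j"
          using ij by (auto simp: U_def)
        then show "p i j y = restr (tetra x)
          (coeff_fun i j (\<lambda>y. grad j \<bullet> v i y) (\<lambda>y. grad i \<bullet> v j y) (r i j)) y"
          using ij proj_in_face[OF ij(1-3), of y] proj_in_face[OF ij(2,1) ij(3)[symmetric], of y]
          by (auto simp: uhr(1)[OF p] restr_apply grad_v intro!: coeff_fun_cong)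
      qed
      then show "\<tau> y = (assemble v + c) y"
        using assemble_plus_bubble_eq[of v y r] by (simp add: c_def)
    qed
  qed
qed

section \<open>The degrees of freedom\<close>

lemma face_vertices: "{a, b, c} = V - {i} \<Longrightarrow> face x i = convex hull {x a, x b, x c}"
  unfolding face_V by (drule sym) simp

lemma face_integral_eq:
  assumes i: "i \<in> V" and abc: "{a, b, c} = V - {i}" and f: "continuous_on (face x i) f"
  shows "face_integral x i f = triangle_integral (x a) (x b) (x c) f"
proof -
  define js where "js = sorted_list_of_set (V - {i})"
  have card: "card (V - {i}) = 3"
    using i by (simp add: card_V)
  have "length js = 3" and set: "set js = V - {i}"
    unfolding js_def using card by simp_all
  then obtain p q r where js: "js = [p, q, r]"
    by (auto simp: numeral_3_eq_3 length_Suc_conv)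
  have pqr: "x ` {p, q, r} = x ` {a, b, c}"
    using set js abc by simp
  have "card (x ` {a, b, c}) = 3"
    unfolding abc using card card_image[OF inj_on_subset[OF inj_x, of "V - {i}"]] by auto
  then have "triangle_integral (x p) (x q) (x r) f = triangle_integral (x a) (x b) (x c) f"
    using pqr f unfolding face_vertices[OF abc] by (intro triangle_integral_perm) simp_all
  then show ?thesis
    unfolding face_integral_def V_def[symmetric] js_def[symmetric] Let_def js by simp
qed

lemma tri_area_nonzero:
  assumes "{a, b, c} = V - {i}" "a \<noteq> b" "a \<noteq> c" "b \<noteq> c"
  shows "tri_area (x a) (x b) (x c) \<noteq> 0"
proof
  assume "tri_area (x a) (x b) (x c) = 0"
  then have "collinear {0, tangent x a b, tangent x a c}"
    by (simp add: tri_area_def tangent_def cross_eq_0)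
  moreover have V: "a \<in> V" "b \<in> V" "c \<in> V"
    using assms(1) by auto
  moreover have "tangent x a b \<noteq> 0" "tangent x a c \<noteq> 0"
    using grad_tangent[of b a b] grad_tangent[of c a c] V assms(2-4) by auto
  ultimately obtain e where e: "tangent x a c = e *\<^sub>R tangent x a b"
    by (auto simp: collinear_lemma)
  have "grad c \<bullet> tangent x a c = e * (grad c \<bullet> tangent x a b)"
    by (simp add: e)
  then show False
    using V assms(2-4) by (simp add: grad_tangent)
qed

lemma tri_param_in_face:
  "{a, b, c} = V - {i} \<Longrightarrow> p \<in> ref_triangle \<Longrightarrow> tri_param (x a) (x b) (x c) p \<in> face x i"
  using tri_param_in_hull[of p "x a" "x b" "x c"] by (simp add: face_vertices)

lemma continuous_on_face_param:
  assumes "{a, b, c} = V - {i}" "continuous_on (face x i) f"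
  shows "continuous_on ref_triangle (\<lambda>p. f (tri_param (x a) (x b) (x c) p))"
  using assms(2) unfolding face_vertices[OF assms(1)] by (rule continuous_on_tri_param)

lemma continuous_on_normal_component:
  fixes \<tau> :: "real^3 \<Rightarrow> real^3^3"
  assumes "i \<in> V" "continuous_on (tetra x) \<tau>" "continuous_on (face x i) v"
  shows "continuous_on (face x i) (\<lambda>y. (\<tau> y *v n) \<bullet> v y)"
proof -
  have "continuous_on (face x i) \<tau>"
    using assms(1,2) face_subset_tetra continuous_on_subset by blast
  moreover have "continuous_on UNIV (\<lambda>A :: real^3^3. A *v n)"
    by (rule linear_continuous_on) (rule linear_conv_bounded_linear[THEN iffD1], rule linear_matrix_vector_mult_left)
  ultimately have "continuous_on (face x i) (\<lambda>y. \<tau> y *v n)"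
    using continuous_on_compose2[of UNIV "\<lambda>A. A *v n" "face x i" \<tau>] by simp
  then show ?thesis
    using assms(3) by (rule continuous_on_inner)
qed

lemma face_dof_eq:
  assumes "i \<in> V" "{a, b, c} = V - {i}" "continuous_on (tetra x) \<tau>" "continuous_on (face x i) v"
  shows "face_dof x i v \<tau> = tri_area (x a) (x b) (x c) *
    (LINT p:ref_triangle|lborel. (\<tau> (tri_param (x a) (x b) (x c) p) *v normal x i) \<bullet>
       v (tri_param (x a) (x b) (x c) p))"
  unfolding face_dof_def
  by (subst face_integral_eq[OF assms(1,2) continuous_on_normal_component[OF assms(1,3,4)]])
    (rule triangle_integral_eq)

lemma face_vertices_exist:
  assumes "i \<in> V"
  obtains a b c where "{a, b, c} = V - {i}"
proof -
  have "card (V - {i}) = 3"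
    using assms by (simp add: card_V)
  then obtain a b c where "V - {i} = {a, b, c}"
    unfolding card_3_iff by (elim exE conjE) (rule that)
  then show ?thesis
    by (intro that) (rule sym)
qed

text \<open>
  Linearity in the test function; it needs the integrals to exist, hence the continuity assumptions.
\<close>

lemma face_dof_span_zero:
  assumes i: "i \<in> V" and \<tau>: "continuous_on (tetra x) \<tau>"
    and B: "\<And>b. b \<in> B \<Longrightarrow> continuous_on (face x i) b" "\<And>b. b \<in> B \<Longrightarrow> face_dof x i b \<tau> = 0"
    and v: "v \<in> span B"
  shows "face_dof x i v \<tau> = 0"
proof -
  obtain a b c where abc: "{a, b, c} = V - {i}"
    using face_vertices_exist[OF i] .
  let ?g = "tri_param (x a) (x b) (x c)"
  let ?I = "\<lambda>v. LINT p:ref_triangle|lborel. (\<tau> (?g p) *v normal x i) \<bullet> v (?g p)"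
  note dof = face_dof_eq[OF i abc \<tau>]
  have integrable: "set_integrable lborel ref_triangle (\<lambda>p. (\<tau> (?g p) *v normal x i) \<bullet> w (?g p))"
    if "continuous_on (face x i) w" for w
    by (intro set_integrable_compact compact_ref_triangle
        continuous_on_face_param[OF abc continuous_on_normal_component[OF i \<tau> that]])
  have "continuous_on (face x i) v \<and> face_dof x i v \<tau> = 0"
    using v
  proof (induction rule: span_induct_alt)
    case base
    have c0: "continuous_on (face x i) (\<lambda>y. 0 :: real^3)"
      by simp
    show ?case
      unfolding zero_fun_def using c0 dof[OF c0] by (simp add: set_lebesgue_integral_def)
  next
    case (step e w q)
    have w: "continuous_on (face x i) w" and q: "continuous_on (face x i) q"
      using B(1) step by auto
    have eq: "e *\<^sub>R w + q = (\<lambda>y. e *\<^sub>R w y + q y)"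
      by (simp add: plus_fun_def scaleR_fun_def)
    have ew: "continuous_on (face x i) (\<lambda>y. e *\<^sub>R w y)"
      using w by (intro continuous_intros)
    have cont: "continuous_on (face x i) (\<lambda>y. e *\<^sub>R w y + q y)"
      using ew q by (rule continuous_on_add)
    have "?I (\<lambda>y. e *\<^sub>R w y + q y) = e * ?I w + ?I q"
      using integrable[OF ew] integrable[OF q] by (simp add: inner_add_right)
    then have "face_dof x i (\<lambda>y. e *\<^sub>R w y + q y) \<tau> = e * face_dof x i w \<tau> + face_dof x i q \<tau>"
      unfolding dof[OF cont] dof[OF w] dof[OF q] by (simp add: algebra_simps)
    then show ?case
      unfolding eq using cont step B(2) by simp
  qed
  then show ?thesis ..
qed

lemma grad_pair:
  assumes "(i, j) \<in> pairs" "{f, g} = {i, j}"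
  shows "f \<in> V" "g \<in> V" "f \<noteq> g"
  using assms pairsD[OF assms(1)] by (auto simp: doubleton_eq_iff)

text \<open>
  The duality between the six matrices and the pairs of gradients; the normal is a negative multiple of
  the gradient, which cancels the sign in \<open>(t\<^sub>i\<^sub>j \<bullet> g\<^sub>i) (t\<^sub>i\<^sub>j \<bullet> g\<^sub>j) = - 1\<close>.
\<close>

lemma matrix_field_normal_component:
  assumes ij: "(i, j) \<in> pairs" "{f, g} = {i, j}"
  shows "(matrix_field P y *v normal x f) \<bullet> grad g = inverse (norm (grad f)) * P i j y"
proof -
  note fg = grad_pair[OF ij]
  have tangential: "(tangent x a b \<bullet> grad f) * (tangent x a b \<bullet> grad g) = (if (a, b) = (i, j) then - 1 else 0)"
    if "(a, b) \<in> pairs" for a b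
    using pairsD[OF that] pairsD[OF ij(1)] ij(2) fg
    by (auto simp: inner_commute[of "tangent x a b"] grad_tangent doubleton_eq_iff)
  have "(matrix_field P y *v normal x f) \<bullet> grad g
      = (\<Sum>(a, b)\<in>pairs. P a b y * ((tangent x a b \<bullet> normal x f) * (tangent x a b \<bullet> grad g)))"
    unfolding matrix_field_def linear_sum[OF linear_matrix_vector_mult_left] inner_sum_left
    by (intro sum.cong refl) (auto simp: linear_scale[OF linear_matrix_vector_mult_left] self_outer_mult_inner)
  also have "\<dots> = (\<Sum>z\<in>pairs. if z = (i, j) then inverse (norm (grad f)) * P i j y else 0)"
  proof (intro sum.cong refl)
    fix z assume "z \<in> pairs"
    then obtain a b where z: "z = (a, b)" "(a, b) \<in> pairs" by (cases z) auto
    have "(tangent x a b \<bullet> normal x f) * (tangent x a b \<bullet> grad g)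
        = - inverse (norm (grad f)) * ((tangent x a b \<bullet> grad f) * (tangent x a b \<bullet> grad g))"
      by (simp add: normal_eq[OF fg(1)])
    also have "\<dots> = (if (a, b) = (i, j) then inverse (norm (grad f)) else 0)"
      unfolding tangential[OF z(2)] by simp
    finally have eq: "(tangent x a b \<bullet> normal x f) * (tangent x a b \<bullet> grad g)
        = (if (a, b) = (i, j) then inverse (norm (grad f)) else 0)" .
    show "(case z of (a, b) \<Rightarrow> P a b y * ((tangent x a b \<bullet> normal x f) * (tangent x a b \<bullet> grad g)))
        = (if z = (i, j) then inverse (norm (grad f)) * P i j y else 0)"
      unfolding z(1) prod.case eq by auto
  qed
  also have "\<dots> = inverse (norm (grad f)) * P i j y"
    using ij(1) finite_pairs by simp
  finally show ?thesis .
qed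

lemma face_from_opposite_edge:
  assumes "i \<in> V" "j \<in> V" "i \<noteq> j" "{l, m} = V - {i, j}"
  shows "{j, l, m} = V - {i}"
proof -
  have "V - {i} = insert j (V - {i, j})"
    using assms(1-3) by auto
  then show ?thesis
    unfolding assms(4)[symmetric] by simp
qed

text \<open>
  Test the normal component with \<open>\<phi>\<close> times the gradient of the other index of the pair.
\<close>

lemma coefficient_moment_zero:
  assumes ij: "(i, j) \<in> pairs" "{f, g} = {i, j}" and lm: "{l, m} = V - {f, g}"
    and \<tau>: "continuous_on (tetra x) \<tau>" "\<And>y. y \<in> tetra x \<Longrightarrow> \<tau> y = matrix_field P y"
    and dof: "\<And>v. v \<in> poly_space k (face x f) \<Longrightarrow> face_dof x f v \<tau> = 0"
    and \<phi>: "\<phi> \<in> polys k"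
  shows "(LINT p:ref_triangle|lborel. P i j (tri_param (x g) (x l) (x m) p) * \<phi> (tri_param (x g) (x l) (x m) p)) = 0"
proof -
  note fg = grad_pair[OF ij]
  note oe = opposite_edge(4-8)[OF fg lm]
  note glm = face_from_opposite_edge[OF fg lm]
  let ?g = "tri_param (x g) (x l) (x m)"
  let ?v = "restr (face x f) (\<lambda>y. \<phi> y *\<^sub>R grad g)"
  have v: "?v \<in> poly_space k (face x f)"
    by (intro poly_spaceI polys_times_const \<phi>)
  have "0 = face_dof x f ?v \<tau>"
    using dof[OF v] by simp
  also have "\<dots> = tri_area (x g) (x l) (x m) *
      (LINT p:ref_triangle|lborel. (\<tau> (?g p) *v normal x f) \<bullet> ?v (?g p))"
    by (rule face_dof_eq[OF fg(1) glm \<tau>(1) continuous_on_poly_space[OF v]])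
  also have "(LINT p:ref_triangle|lborel. (\<tau> (?g p) *v normal x f) \<bullet> ?v (?g p))
      = (LINT p:ref_triangle|lborel. inverse (norm (grad f)) * (P i j (?g p) * \<phi> (?g p)))"
  proof (rule set_lebesgue_integral_cong)
    show "ref_triangle \<in> sets lborel"
      using compact_ref_triangle by (simp add: borel_compact)
    show "\<forall>p. p \<in> ref_triangle \<longrightarrow> (\<tau> (?g p) *v normal x f) \<bullet> ?v (?g p)
        = inverse (norm (grad f)) * (P i j (?g p) * \<phi> (?g p))"
    proof (intro allI impI)
      fix p assume "p \<in> ref_triangle"
      then have g: "?g p \<in> face x f"
        using tri_param_in_face[OF glm] by blast
      then have "\<tau> (?g p) = matrix_field P (?g p)"
        using \<tau>(2) face_subset_tetra[OF fg(1)] by blast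
      then show "(\<tau> (?g p) *v normal x f) \<bullet> ?v (?g p)
          = inverse (norm (grad f)) * (P i j (?g p) * \<phi> (?g p))"
        using g by (simp add: restr_apply matrix_field_normal_component[OF ij])
    qed
  qed
  also have "\<dots> = inverse (norm (grad f)) * (LINT p:ref_triangle|lborel. P i j (?g p) * \<phi> (?g p))"
    by simp
  finally show ?thesis
    using tri_area_nonzero[OF glm] oe grad_nonzero[OF fg(1)] by auto
qed

lemma bary_tri_param:
  assumes "i \<in> V" "j \<in> V" "i \<noteq> j" and lm: "{l, m} = V - {i, j}" and "a \<in> V"
  shows "bary x a (tri_param (x j) (x l) (x m) p) =
    (if a = j then 1 - fst p - snd p else if a = l then fst p else if a = m then snd p else 0)"
proof -
  note oe = opposite_edge(2-8)[OF assms(1-4)]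
  have "tri_param (x j) (x l) (x m) p = x j + (fst p *\<^sub>R tangent x j l + snd p *\<^sub>R tangent x j m)"
    by (simp add: tri_param_def tangent_def)
  then show ?thesis
    using oe assms(1-3,5) by (auto simp: bary_add bary_vertex inner_add_right grad_tangent)
qed

text \<open>
  In the parametrizations that start at \<open>x i\<close> and at \<open>x j\<close> and go on with the same two vertices, the
  projection along the edge becomes the identity of the reference triangle.
\<close>

lemma proj_tri_param:
  assumes ij: "i \<in> V" "j \<in> V" "i \<noteq> j" and lm: "{l, m} = V - {i, j}"
  shows "proj i j (tri_param (x i) (x l) (x m) p) = tri_param (x j) (x l) (x m) p"
proof (rule point_eqI)
  fix a assume a: "a \<in> V"
  have lm': "{l, m} = V - {j, i}"
    using lm by (simp add: insert_commute)
  note oe = opposite_edge(2-8)[OF ij lm]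
  show "bary x a (proj i j (tri_param (x i) (x l) (x m) p)) = bary x a (tri_param (x j) (x l) (x m) p)"
    using a ij oe
    by (simp add: bary_proj bary_tri_param[OF ij lm] bary_tri_param[OF ij(2,1) ij(3)[symmetric] lm'])
qed

lemma face_point_param:
  assumes ij: "i \<in> V" "j \<in> V" "i \<noteq> j" and lm: "{l, m} = V - {i, j}" and y: "y \<in> face x i"
  shows "(bary x l y, bary x m y) \<in> ref_triangle"
    and "tri_param (x j) (x l) (x m) (bary x l y, bary x m y) = y"
proof -
  note oe = opposite_edge(2-8)[OF ij lm]
  have nonneg: "0 \<le> bary x a y" if "a \<in> V" for a
    using y ij(1) that by (simp add: face_eq tetra_eq)
  have zero: "bary x i y = 0"
    using y ij(1) by (simp add: face_eq)
  have sum: "bary x j y = 1 - bary x l y - bary x m y"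
    using sum_bary[of y] unfolding sum_opposite_edge[OF ij lm] zero by simp
  show "(bary x l y, bary x m y) \<in> ref_triangle"
    using nonneg[OF ij(2)] nonneg oe unfolding sum by (simp add: ref_triangle_def)
  show "tri_param (x j) (x l) (x m) (bary x l y, bary x m y) = y"
  proof (rule point_eqI)
    fix a assume a: "a \<in> V"
    then have "a = i \<or> a = j \<or> a = l \<or> a = m"
      using opposite_edge(1)[OF ij lm] by blast
    then show "bary x a (tri_param (x j) (x l) (x m) (bary x l y, bary x m y)) = bary x a y"
      using a ij oe zero sum by (auto simp: bary_tri_param[OF ij lm])
  qed
qed

text \<open>
  On the reference triangle, the traces of the coefficient on the two faces are \<open>U + w H\<close> and
  \<open>U - w H\<close>, where \<open>w\<close> vanishes on the common edge. The sum of the two conditions tested with \<open>U\<close>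
  gives \<open>\<integral> U\<^sup>2 = 0\<close>; their difference tested with \<open>H\<close> gives \<open>\<integral> w H\<^sup>2 = 0\<close>. Both tests are admissible on
  both faces, since the projections carry polynomials on one face to polynomials on the other.
\<close>

lemma traces_zero:
  assumes ij: "(i, j) \<in> pairs"
    and \<tau>: "continuous_on (tetra x) \<tau>" "\<And>y. y \<in> tetra x \<Longrightarrow> \<tau> y = matrix_field P y"
    and dof: "\<And>f v. f \<in> V \<Longrightarrow> v \<in> poly_space k (face x f) \<Longrightarrow> face_dof x f v \<tau> = 0"
    and uh: "u \<in> polys k" "h \<in> polys k"
    and P: "\<And>y. y \<in> tetra x \<Longrightarrow> P i j y = coeff_fun i j u h r y"
  shows "(\<forall>y\<in>face x i. u y = 0) \<and> (\<forall>y\<in>face x j. h y = 0)"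
proof -
  have ijV: "i \<in> V" "j \<in> V" "i \<noteq> j" using pairsD[OF ij] by auto
  note jiV = ijV(2,1) ijV(3)[symmetric]
  obtain l m where lm: "{l, m} = V - {i, j}"
    using opposite_edge_exists[OF ijV] .
  then have lm': "{l, m} = V - {j, i}"
    by (simp add: insert_commute)
  note oe = opposite_edge(2-8)[OF ijV lm]
  define gi where "gi = tri_param (x j) (x l) (x m)"
  define gj where "gj = tri_param (x i) (x l) (x m)"
  have faces: "gi p \<in> face x i" "gj p \<in> face x j" if "p \<in> ref_triangle" for p
  proof -
    have 1: "{j, l, m} = V - {i}" "{i, l, m} = V - {j}"
      by (rule face_from_opposite_edge[OF ijV lm] face_from_opposite_edge[OF jiV lm'])+
    show "gi p \<in> face x i" "gj p \<in> face x j"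
      unfolding gi_def gj_def by (intro tri_param_in_face[OF 1(1) that] tri_param_in_face[OF 1(2) that])+
  qed
  have proj: "proj i j (gj p) = gi p" "proj j i (gi p) = gj p" "proj i j (gi p) = gi p" "proj j i (gj p) = gj p" for p
  proof -
    show "proj i j (gj p) = gi p" "proj j i (gi p) = gj p"
      unfolding gi_def gj_def by (rule proj_tri_param[OF ijV lm] proj_tri_param[OF jiV lm'])+
    have "bary x i (gi p) = 0" "bary x j (gj p) = 0"
      using ijV oe by (simp_all add: gi_def gj_def bary_tri_param[OF ijV lm] bary_tri_param[OF jiV lm'])
    then show "proj i j (gi p) = gi p" "proj j i (gj p) = gj p"
      by (simp_all add: proj_id)
  qed
  define U where "U p = u (gi p)" for p
  define H where "H p = h (gj p)" for p
  define w :: "real \<times> real \<Rightarrow> real" where "w p = 1 - fst p - snd p" for p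
  have Pi: "P i j (gi p) = U p + w p * H p" and Pj: "P i j (gj p) = U p - w p * H p"
    if "p \<in> ref_triangle" for p
  proof -
    have "gi p \<in> tetra x" "gj p \<in> tetra x"
      using faces[OF that] face_subset_tetra ijV by auto
    then show "P i j (gi p) = U p + w p * H p" "P i j (gj p) = U p - w p * H p"
      using oe ijV unfolding U_def H_def w_def
      by (simp_all add: P coeff_fun_def proj)
        (simp_all add: gi_def gj_def bary_tri_param[OF ijV lm] bary_tri_param[OF jiV lm'] algebra_simps)
  qed
  have sets: "ref_triangle \<in> sets lborel"
    using compact_ref_triangle by (simp add: borel_compact)
  have mi: "(LINT p:ref_triangle|lborel. (U p + w p * H p) * \<phi> (gi p)) = 0" if "\<phi> \<in> polys k" for \<phi>
  proof -
    have "(LINT p:ref_triangle|lborel. (U p + w p * H p) * \<phi> (gi p))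
        = (LINT p:ref_triangle|lborel. P i j (gi p) * \<phi> (gi p))"
      by (rule set_lebesgue_integral_cong[OF sets]) (simp add: Pi)
    then show ?thesis
      using coefficient_moment_zero[OF ij refl lm \<tau> dof[OF ijV(1)] that] by (simp add: gi_def)
  qed
  have mj: "(LINT p:ref_triangle|lborel. (U p - w p * H p) * \<phi> (gj p)) = 0" if "\<phi> \<in> polys k" for \<phi>
  proof -
    have "(LINT p:ref_triangle|lborel. (U p - w p * H p) * \<phi> (gj p))
        = (LINT p:ref_triangle|lborel. P i j (gj p) * \<phi> (gj p))"
      by (rule set_lebesgue_integral_cong[OF sets]) (simp add: Pj)
    then show ?thesis
      using coefficient_moment_zero[OF ij insert_commute lm' \<tau> dof[OF ijV(2)] that] by (simp add: gj_def)
  qed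
  have cont: "continuous_on ref_triangle U" "continuous_on ref_triangle H" "continuous_on ref_triangle w"
  proof -
    have "continuous_on ref_triangle gi" "continuous_on ref_triangle gj"
      unfolding gi_def gj_def tri_param_def[abs_def] by (intro continuous_intros)+
    then show "continuous_on ref_triangle U" "continuous_on ref_triangle H"
      unfolding U_def[abs_def] H_def[abs_def]
      by (auto intro: continuous_on_compose2[OF continuous_on_poly_space[OF uh(1)]]
          continuous_on_compose2[OF continuous_on_poly_space[OF uh(2)]])
    show "continuous_on ref_triangle w"
      unfolding w_def[abs_def] by (intro continuous_intros)
  qed
  note int = set_integrable_compact[OF compact_ref_triangle]
  have "(LINT p:ref_triangle|lborel. 1 * (U p)\<^sup>2) = 0"
  proof -
    have 1: "(LINT p:ref_triangle|lborel. (U p + w p * H p) * U p) = 0"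
      using mi[OF uh(1)] by (simp add: U_def)
    have 2: "(LINT p:ref_triangle|lborel. (U p - w p * H p) * U p) = 0"
      using mj[OF polys_proj[OF ijV(1) uh(1), of j]] by (simp add: U_def proj)
    have "(LINT p:ref_triangle|lborel. (U p + w p * H p) * U p + (U p - w p * H p) * U p) = 0"
      by (subst set_integral_add(2)) (auto simp: 1 2 intro!: int continuous_intros cont)
    moreover have "(U p + w p * H p) * U p + (U p - w p * H p) * U p = 2 * (U p)\<^sup>2" for p
      by (simp add: power2_eq_square algebra_simps)
    ultimately show ?thesis by simp
  qed
  then have U0: "U p = 0" if "p \<in> ref_triangle" for p
    using that cont by (intro set_integral_weighted_square_zero[OF compact_ref_triangle
          convex_ref_triangle interior_ref_triangle_nonempty, of U "\<lambda>_. 1"]) auto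
  have "(LINT p:ref_triangle|lborel. w p * (H p)\<^sup>2) = 0"
  proof -
    have 1: "(LINT p:ref_triangle|lborel. (U p + w p * H p) * H p) = 0"
      using mi[OF polys_proj[OF ijV(2) uh(2), of i]] by (simp add: H_def proj)
    have 2: "(LINT p:ref_triangle|lborel. (U p - w p * H p) * H p) = 0"
      using mj[OF uh(2)] by (simp add: H_def)
    have "(LINT p:ref_triangle|lborel. (U p + w p * H p) * H p - (U p - w p * H p) * H p) = 0"
      by (subst set_integral_diff(2)) (auto simp: 1 2 intro!: int continuous_intros cont)
    moreover have "(U p + w p * H p) * H p - (U p - w p * H p) * H p = 2 * (w p * (H p)\<^sup>2)" for p
      by (simp add: power2_eq_square algebra_simps)
    ultimately show ?thesis by simp
  qed
  moreover have w_nonneg: "0 \<le> w p" if "p \<in> ref_triangle" for p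
    using that by (auto simp: w_def ref_triangle_def)
  moreover have w_pos: "0 < w p" if "p \<in> interior ref_triangle" for p
    using that by (auto simp: w_def interior_ref_triangle)
  ultimately have H0: "H p = 0" if "p \<in> ref_triangle" for p
    using that cont by (intro set_integral_weighted_square_zero[OF compact_ref_triangle
          convex_ref_triangle interior_ref_triangle_nonempty, of H w] w_nonneg w_pos)
  show ?thesis
  proof (intro conjI ballI)
    fix y assume y: "y \<in> face x i"
    show "u y = 0"
      using U0[OF face_point_param(1)[OF ijV lm y]] face_point_param(2)[OF ijV lm y]
      by (simp add: U_def gi_def)
  next
    fix y assume y: "y \<in> face x j"
    show "h y = 0"
      using H0[OF face_point_param(1)[OF jiV lm' y]] face_point_param(2)[OF jiV lm' y]
      by (simp add: H_def gj_def)
  qed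
qed

section \<open>Unisolvence\<close>

lemma interior_dof_span_zero:
  assumes \<tau>: "continuous_on (tetra x) \<tau>"
    and C: "\<And>c. c \<in> C \<Longrightarrow> continuous_on (tetra x) c" "\<And>c. c \<in> C \<Longrightarrow> interior_dof x c \<tau> = 0"
    and c: "c \<in> span C"
  shows "interior_dof x c \<tau> = 0"
proof -
  have "continuous_on (tetra x) c \<and> interior_dof x c \<tau> = 0"
    using c
  proof (induction rule: span_induct_alt)
    case base
    show ?case
      unfolding zero_fun_def by (simp add: interior_dof_def set_lebesgue_integral_def)
  next
    case (step e w q)
    have w: "continuous_on (tetra x) w" and q: "continuous_on (tetra x) q"
      using C(1) step by auto
    have int: "set_integrable lborel (tetra x) (\<lambda>y. \<tau> y \<bullet> p y)" if "continuous_on (tetra x) p" for p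
      using \<tau> that by (intro set_integrable_compact compact_tetra continuous_intros)
    have ew: "continuous_on (tetra x) (\<lambda>y. e *\<^sub>R w y)"
      using w by (intro continuous_intros)
    have eq: "e *\<^sub>R w + q = (\<lambda>y. e *\<^sub>R w y + q y)"
      by (simp add: plus_fun_def scaleR_fun_def)
    have "continuous_on (tetra x) (\<lambda>y. e *\<^sub>R w y + q y)"
      using ew q by (rule continuous_on_add)
    moreover have "interior_dof x (\<lambda>y. e *\<^sub>R w y + q y) \<tau> = e * interior_dof x w \<tau> + interior_dof x q \<tau>"
      using int[OF ew] int[OF q] unfolding interior_dof_def by (simp add: inner_add_right)
    ultimately show ?case
      unfolding eq using step C(2) by simp
  qed
  then show ?thesis ..
qed

lemma bubble_zero:
  assumes c: "c \<in> H_bubble x k" and zero: "interior_dof x c c = 0"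
  shows "c = 0"
proof
  fix y
  have "norm (c y) = 0" if "y \<in> tetra x"
  proof (rule set_integral_weighted_square_zero[OF compact_tetra convex_tetra interior_tetra_nonempty,
        of "\<lambda>y. norm (c y)" "\<lambda>_. 1"])
    show "continuous_on (tetra x) (\<lambda>y. norm (c y))"
      using continuous_on_H_bubble[OF c] by (intro continuous_intros)
    show "(LINT y:tetra x|lborel. 1 * (norm (c y))\<^sup>2) = 0"
      using zero by (simp add: interior_dof_def power2_norm_eq_inner)
  qed (use that in auto)
  then show "c y = 0 y"
    using H_bubble_outside[OF c, of y] by (cases "y \<in> tetra x") auto
qed

text \<open>
  For a fixed face the conditions from its three edges annihilate three gradient components of \<open>v i\<close>,
  hence \<open>v i\<close> itself. The bubble that is left is then tested with itself.
\<close>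

lemma decomposition_unisolvent:
  assumes k: "k \<ge> 1" and v: "\<And>i. i \<in> V \<Longrightarrow> v i \<in> poly_space k (face x i)"
    and c: "c \<in> H_bubble x k"
    and face: "\<And>i w. i \<in> V \<Longrightarrow> w \<in> poly_space k (face x i) \<Longrightarrow> face_dof x i w (assemble v + c) = 0"
    and interior: "\<And>p. p \<in> H_bubble x k \<Longrightarrow> interior_dof x p (assemble v + c) = 0"
  shows "i \<in> V \<Longrightarrow> v i = 0" and "c = 0"
proof -
  obtain w r where w: "\<And>i. i \<in> V \<Longrightarrow> w i \<in> polys k" "\<And>i. i \<in> V \<Longrightarrow> v i = restr (face x i) (w i)"
    and eq: "assemble v + c = matrix_field (\<lambda>i j. restr (tetra x)
      (coeff_fun i j (\<lambda>y. grad j \<bullet> w i y) (\<lambda>y. grad i \<bullet> w j y) (r i j)))"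
    by (rule assemble_plus_bubble_polys[OF v c], assumption) (rule that)
  let ?P = "\<lambda>i j. restr (tetra x)
      (coeff_fun i j (\<lambda>y. grad j \<bullet> w i y) (\<lambda>y. grad i \<bullet> w j y) (r i j))"
  have cont: "continuous_on (tetra x) (assemble v + c)"
    by (rule continuous_on_Sigma_nc[OF k assemble_in_Sigma_nc[OF k v c]])
  have traces: "(\<forall>y\<in>face x i. grad j \<bullet> w i y = 0) \<and> (\<forall>y\<in>face x j. grad i \<bullet> w j y = 0)"
    if "(i, j) \<in> pairs" for i j
  proof (rule traces_zero[OF that cont _ face])
    show "(assemble v + c) y = matrix_field ?P y" for y
      unfolding eq ..
    show "(\<lambda>y. grad j \<bullet> w i y) \<in> polys k" "(\<lambda>y. grad i \<bullet> w j y) \<in> polys k"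
      using pairsD[OF that] w(1) by (auto intro: polys_inner)
    show "?P i j y = coeff_fun i j (\<lambda>y. grad j \<bullet> w i y) (\<lambda>y. grad i \<bullet> w j y) (r i j) y"
      if "y \<in> tetra x" for y
      using that by (simp add: restr_apply)
  qed
  show v0: "v i = 0" if i: "i \<in> V" for i
  proof
    fix y
    have "w i y = 0" if y: "y \<in> face x i"
    proof (rule vector_eqI_grad[OF i])
      fix j assume j: "j \<in> V - {i}"
      then have "(i, j) \<in> pairs \<or> (j, i) \<in> pairs"
        using i by (auto simp: pairs_def)
      then show "grad j \<bullet> w i y = 0"
        using traces y by blast
    qed
    then show "v i y = 0 y"
      by (simp add: w(2)[OF i] restr_apply)
  qed
  have "assemble v + c = c"
    using assemble_zero[of v] v0 by simp
  then show "c = 0"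
    using bubble_zero[OF c] interior[OF c] by simp
qed

lemma dof_zero [simp]: "face_dof x i v 0 = 0" "interior_dof x p 0 = 0"
  by (simp_all add: face_dof_def interior_dof_def face_integral_def triangle_integral_def
      set_lebesgue_integral_def Let_def)

text \<open>
  A basis of the shape function space, indexed by the degrees of freedom themselves: a basis field on a face
  is assembled with zero fields on the other faces, and the basis of the bubble space is kept. Independence is the
  uniqueness in the decomposition, applied to the field \<open>0\<close>, all of whose degrees of freedom vanish.
\<close>

lemma Sigma_nc_unisolvent:
  assumes k: "k \<ge> 1"
    and B: "\<And>i. i \<in> V \<Longrightarrow> is_basis (B i) (poly_space k (face x i))"
    and C: "is_basis C (H_bubble x k)"
  shows "unisolvent ((SIGMA i:V. B i) <+> C)
    (case_sum (\<lambda>(i, v). face_dof x i v) (\<lambda>p. interior_dof x p)) (Sigma_nc x k)"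
proof -
  let ?I = "(SIGMA i:V. B i) <+> C"
  have finB: "finite (B i)" if "i \<in> V" for i
    using finite_basis[OF B[OF that] poly_space_finitely_spanned] .
  have finC: "finite C"
    using finite_basis[OF C H_bubble_finitely_spanned] .
  have finS: "finite (SIGMA i:V. B i)"
    using finB by (intro finite_SigmaI) auto
  have finI: "finite ?I"
    using finS finC by simp
  have spanB: "span (B i) = poly_space k (face x i)" if "i \<in> V" for i
    using B[OF that] by (simp add: is_basis_def)
  have spanC: "span C = H_bubble x k"
    using C by (simp add: is_basis_def)
  define e where "e = case_sum (\<lambda>(i, b). assemble (\<lambda>i'. if i' = i then b else 0)) (\<lambda>c. c)"
  define trace where "trace a i = (\<Sum>b\<in>B i. a (Inl (i, b)) *\<^sub>R b)" for a :: "nat \<times> (real^3 \<Rightarrow> real^3) + (real^3 \<Rightarrow> real^3^3) \<Rightarrow> real" and i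
  define bubble where "bubble a = (\<Sum>c\<in>C. a (Inr c) *\<^sub>R c)" for a :: "nat \<times> (real^3 \<Rightarrow> real^3) + (real^3 \<Rightarrow> real^3^3) \<Rightarrow> real"
  have trace: "trace a i \<in> poly_space k (face x i)" if "i \<in> V" for a i
    unfolding trace_def spanB[OF that, symmetric] by (intro span_sum span_scale span_base)
  have bubble: "bubble a \<in> H_bubble x k" for a
    unfolding bubble_def spanC[symmetric] by (intro span_sum span_scale span_base)
  have comb: "(\<Sum>z\<in>?I. a z *\<^sub>R e z) = assemble (trace a) + bubble a" for a
  proof -
    let ?f = "\<lambda>z i'. if i' = fst z then snd z else 0"
    have "(\<Sum>z\<in>?I. a z *\<^sub>R e z) = (\<Sum>z\<in>(SIGMA i:V. B i). a (Inl z) *\<^sub>R assemble (?f z)) + bubble a"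
      unfolding sum.Plus[OF finS finC] by (simp add: e_def bubble_def case_prod_beta)
    also have "(\<Sum>z\<in>(SIGMA i:V. B i). a (Inl z) *\<^sub>R assemble (?f z))
        = assemble (\<lambda>i'. \<Sum>z\<in>(SIGMA i:V. B i). a (Inl z) *\<^sub>R ?f z i')"
      by (rule assemble_sum[OF finS, symmetric])
    also have "\<dots> = assemble (trace a)"
    proof (rule assemble_cong)
      fix i' assume i': "i' \<in> V"
      have "(\<Sum>z\<in>(SIGMA i:V. B i). a (Inl z) *\<^sub>R ?f z i')
          = (\<Sum>i\<in>V. \<Sum>b\<in>B i. a (Inl (i, b)) *\<^sub>R ?f (i, b) i')"
        using finB by (subst sum.Sigma) (auto simp: case_prod_beta cong: if_cong)
      also have "\<dots> = (\<Sum>i\<in>V. if i = i' then trace a i' else 0)"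
        by (rule sum.cong) (auto simp: trace_def)
      also have "\<dots> = trace a i'"
        using i' by simp
      finally show "(\<Sum>z\<in>(SIGMA i:V. B i). a (Inl z) *\<^sub>R ?f z i') = trace a i'" .
    qed
    finally show ?thesis .
  qed
  have coefficients_zero: "a z = 0" if zero: "(\<Sum>z\<in>?I. a z *\<^sub>R e z) = 0" and z: "z \<in> ?I" for a z
  proof -
    have tau: "assemble (trace a) + bubble a = 0"
      using zero unfolding comb .
    have v0: "trace a i = 0" if "i \<in> V" for i
      by (rule decomposition_unisolvent(1)[OF k trace bubble[of a] _ _ that]) (simp_all add: tau)
    have c0: "bubble a = 0"
      by (rule decomposition_unisolvent(2)[OF k trace[of _ a] bubble[of a]]) (simp_all add: tau)
    show "a z = 0"
    proof (cases z)
      case (Inl ib)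
      then obtain i b where ib: "z = Inl (i, b)" "i \<in> V" "b \<in> B i"
        using z by auto
      then show ?thesis
        using independentD[of "B i" "B i" "\<lambda>b. a (Inl (i, b))" b] v0[of i] finB B
        by (simp add: trace_def is_basis_def)
    next
      case (Inr c)
      then show ?thesis
        using independentD[of C C "\<lambda>c. a (Inr c)" c] c0 finC C z
        by (auto simp: bubble_def is_basis_def)
    qed
  qed
  have indep: "inj_on e ?I" "independent (e ` ?I)"
    by (rule independent_family[OF finI], erule coefficients_zero, assumption)+
  have Sigma: "Sigma_nc x k = span (e ` ?I)"
  proof (intro equalityI subsetI)
    fix \<tau> assume "\<tau> \<in> Sigma_nc x k"
    from k this obtain v c where v: "\<And>i. i \<in> V \<Longrightarrow> v i \<in> poly_space k (face x i)"
      and c: "c \<in> H_bubble x k" and \<tau>: "\<tau> = assemble v + c"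
      by (rule Sigma_nc_decompose) (rule that)
    have "\<exists>u. i \<in> V \<longrightarrow> v i = (\<Sum>b\<in>B i. u b *\<^sub>R b)" for i
    proof (cases "i \<in> V")
      case True
      have "v i \<in> range (\<lambda>u. \<Sum>b\<in>B i. u b *\<^sub>R b)"
        using v[OF True] unfolding spanB[OF True, symmetric] span_finite[OF finB[OF True]] .
      then obtain u where "v i = (\<Sum>b\<in>B i. u b *\<^sub>R b)"
        by (rule rangeE)
      then show ?thesis by blast
    qed simp
    then have "\<exists>u. \<forall>i. i \<in> V \<longrightarrow> v i = (\<Sum>b\<in>B i. u i b *\<^sub>R b)"
      by (intro choice allI)
    then obtain u where u: "\<And>i. i \<in> V \<Longrightarrow> v i = (\<Sum>b\<in>B i. u i b *\<^sub>R b)"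
      by (elim exE) (rule that, simp)
    obtain g where g: "c = (\<Sum>b\<in>C. g b *\<^sub>R b)"
      using c unfolding spanC[symmetric] span_finite[OF finC] by (rule rangeE)
    let ?a = "case_sum (\<lambda>(i, b). u i b) g"
    have "\<tau> = assemble (trace ?a) + bubble ?a"
      unfolding \<tau> by (intro arg_cong2[of _ _ _ _ "(+)"] assemble_cong) (simp_all only: trace_def bubble_def u g prod.case sum.case)
    then have "\<tau> = (\<Sum>z\<in>?I. ?a z *\<^sub>R e z)"
      unfolding comb .
    then show "\<tau> \<in> span (e ` ?I)"
      by (simp only:) (intro span_sum span_scale span_base imageI)
  next
    fix \<tau> assume "\<tau> \<in> span (e ` ?I)"
    then obtain u where "\<tau> = (\<Sum>t\<in>e ` ?I. u t *\<^sub>R t)"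
      unfolding span_finite[OF finite_imageI[OF finI]] by (rule rangeE)
    then have "\<tau> = (\<Sum>z\<in>?I. u (e z) *\<^sub>R e z)"
      by (simp add: sum.reindex[OF indep(1)])
    then show "\<tau> \<in> Sigma_nc x k"
      unfolding comb using assemble_in_Sigma_nc[OF k trace bubble] by simp
  qed
  have card: "card ?I = dim (Sigma_nc x k)"
    unfolding Sigma dim_span using dim_eq_card_independent[OF indep(2)] card_image[OF indep(1)] by simp
  have "\<tau> = 0" if \<tau>: "\<tau> \<in> Sigma_nc x k"
    and dofs: "\<And>z. z \<in> ?I \<Longrightarrow> case_sum (\<lambda>(i, v). face_dof x i v) (\<lambda>p. interior_dof x p) z \<tau> = 0" for \<tau>
  proof -
    obtain v c where v: "\<And>i. i \<in> V \<Longrightarrow> v i \<in> poly_space k (face x i)"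
      and c: "c \<in> H_bubble x k" and eq: "\<tau> = assemble v + c"
      by (rule Sigma_nc_decompose[OF k \<tau>]) (rule that)
    note cont = continuous_on_Sigma_nc[OF k \<tau>]
    have face: "face_dof x i w (assemble v + c) = 0" if "i \<in> V" "w \<in> poly_space k (face x i)" for i w
      unfolding eq[symmetric]
    proof (rule face_dof_span_zero[OF that(1) cont])
      show "w \<in> span (B i)"
        using that spanB by simp
      show "continuous_on (face x i) b" if "b \<in> B i" for b
        using spanB[OF \<open>i \<in> V\<close>] span_base[OF that] by (auto intro: continuous_on_poly_space)
      show "face_dof x i b \<tau> = 0" if "b \<in> B i" for b
        using dofs[of "Inl (i, b)"] that \<open>i \<in> V\<close> by auto
    qed
    have interior: "interior_dof x p (assemble v + c) = 0" if "p \<in> H_bubble x k" for p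
      unfolding eq[symmetric]
    proof (rule interior_dof_span_zero[OF cont])
      show "p \<in> span C"
        using that spanC by simp
      show "continuous_on (tetra x) b" if "b \<in> C" for b
        using spanC span_base[OF that] by (auto intro: continuous_on_H_bubble)
      show "interior_dof x b \<tau> = 0" if "b \<in> C" for b
        using dofs[of "Inr b"] that by auto
    qed
    have zero: "v i = 0" if "i \<in> V" for i
      by (rule decomposition_unisolvent(1)[OF k v c face interior that])
    moreover have "c = 0"
      by (rule decomposition_unisolvent(2)[OF k v c face interior])
    ultimately show "\<tau> = 0"
      unfolding eq using assemble_zero[of v] zero by simp
  qed
  then show ?thesis
    unfolding unisolvent_def using finI card by blast
qed

end

theorem theorem5p2:
  fixes k :: nat
    and x :: "nat \<Rightarrow> real^3"
    and B :: "nat \<Rightarrow> (real^3 \<Rightarrow> real^3) set"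
    and C :: "(real^3 \<Rightarrow> real^3^3) set"
  assumes "k \<ge> 1"
    and "nondegenerate x"
    and "\<And>i. i \<in> {1..4} \<Longrightarrow> is_basis (B i) (poly_space k (face x i))"
    and "is_basis C (H_bubble x k)"
  shows "unisolvent ((SIGMA i:{1..4}. B i) <+> C)
           (case_sum (\<lambda>(i, v). face_dof x i v) (\<lambda>p. interior_dof x p))
           (Sigma_nc x k)"
proof -
  interpret tetrahedron x
    by unfold_locales (rule assms(2))
  show ?thesis
    using Sigma_nc_unisolvent[OF assms(1) _ assms(4)] assms(3) unfolding V_def .
qed

end
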